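(* Let $k\ge 2$ be a fixed integer. Let $F$ be an absolutely continuous distribution function on $\mathbb{R}$ with probability density function $f$ which is nonincreasing on $(l(F),r(F))$ and eventually positive, that is, $f(x)>0$ for all $x<r(F)$ sufficiently close to $r(F)$. Let $G$ be a nondegenerate distribution function and suppose $F\in\mathcal{D}(G)$ with norming constants $a_n>0$, $b_n\in\mathbb{R}$, so that $$\lim_{n\to\infty}P(X_{n-k+1:n}\le a_nx+b_n)=G(x)\sum_{i=0}^{k-1}\frac{(-\log G(x))^i}{i!}\quad\text{for } x\in\{y:G(y)>0\}.$$ Suppose that the entropy $h(f)$ of $f$ exists. Let $g_n^{(k)}$ be the density of $(X_{n-k+1:n}-b_n)/a_n$. (i) If $G=\Phi_\alpha$ for some $\alpha>0$, then $\lim_{n\to\infty}h(g_n^{(k)})=h(\phi_\alpha^{(k)})$. (ii) If $G=\Psi_\alpha$ for some $\alpha>0$, then $\lim_{n\to\infty}h(g_n^{(k)})=h(\psi_\alpha^{(k)})$. (iii) If $G=\Lambda$, then $\lim_{n\to\infty}h(g_n^{(k)})=h(\lambda^{(k)})$.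
   Context: Entropy: for a probability density $p$ on $\mathbb{R}$, $h(p)=-\int_{\{p>0\}}p(x)\log p(x)\,dx$ (natural logarithm); the entropy of $p$ exists if this integral exists and is finite. Endpoints: $l(F)=\inf\{x:F(x)>0\}\ge-\infty$ and $r(F)=\sup\{x:F(x)<1\}\le\infty$. Order statistics: $X_1,X_2,\ldots$ are i.i.d. random variables with distribution function $F$, and $X_{1:n}\le\cdots\le X_{n:n}$ are the order statistics of $X_1,\ldots,X_n$; thus $X_{n-k+1:n}$ is the $k$-th largest among them. Max domain of attraction: $F\in\mathcal{D}(G)$ with norming constants $a_n>0$, $b_n\in\mathbb{R}$ means $\lim_{n\to\infty}F^n(a_nx+b_n)=G(x)$ at every continuity point $x$ of the nondegenerate distribution function $G$. Density of the normalized $k$-th extreme (for $n\ge k$), with $\bar F=1-F$: $$g_n^{(k)}(x)=\frac{n!}{(k-1)!\,(n-k)!}\,a_nf(a_nx+b_n)\,F^{n-k}(a_nx+b_n)\,\bar F^{\,k-1}(a_nx+b_n),\quad x\in\mathbb{R}.$$ Max stable laws: $\Phi_\alpha(x)=\exp(-x^{-\alpha})$ for $x>0$ and $0$ for $x\le0$ (Fréchet); $\Psi_\alpha(x)=\exp(-|x|^\alpha)$ for $x<0$ and $1$ for $x\ge0$ (Weibull); $\Lambda(x)=\exp(-e^{-x})$ for $x\in\mathbb{R}$ (Gumbel). Limit densities: $\phi_\alpha^{(k)}(x)=\frac{\alpha}{(k-1)!}x^{-\alpha k-1}e^{-x^{-\alpha}}$ for $x>0$ and $0$ for $x\le0$;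 $\psi_\alpha^{(k)}(x)=\frac{\alpha}{(k-1)!}(-x)^{\alpha k-1}e^{-(-x)^\alpha}$ for $x<0$ and $0$ for $x\ge0$; $\lambda^{(k)}(x)=\frac{1}{(k-1)!}e^{-kx}e^{-e^{-x}}$ for $x\in\mathbb{R}$. *)

theory Defs
  imports "HOL-Probability.Probability"
begin

definition entropy_exists :: "(real \<Rightarrow> real) \<Rightarrow> bool" where
  "entropy_exists p \<longleftrightarrow> set_integrable lborel {x. p x > 0} (\<lambda>x. p x * ln (p x))"

text \<open>The value is meaningful only if \<^term>\<open>entropy_exists p\<close>: the Bochner integral of a
  non-integrable function is 0.\<close>

definition diff_entropy :: "(real \<Rightarrow> real) \<Rightarrow> real" where
  "diff_entropy p = - (LINT x:{x. p x > 0}|lborel. p x * ln (p x))"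

definition distribution_function :: "(real \<Rightarrow> real) \<Rightarrow> bool" where
  "distribution_function F \<longleftrightarrow> (\<exists>D. real_distribution D \<and> F = cdf D)"

definition nondegenerate :: "(real \<Rightarrow> real) \<Rightarrow> bool" where
  "nondegenerate G \<longleftrightarrow> \<not> (\<exists>c. \<forall>x. G x = (if c \<le> x then 1 else 0))"

text \<open>The existence of such an \<^term>\<open>f\<close> is absolute continuity of \<^term>\<open>F\<close>.\<close>

definition has_pdf :: "(real \<Rightarrow> real) \<Rightarrow> (real \<Rightarrow> real) \<Rightarrow> bool" where
  "has_pdf F f \<longleftrightarrow>
     f \<in> borel_measurable borel \<and> (\<forall>x. 0 \<le> f x) \<and>
     prob_space (density lborel (\<lambda>x. ennreal (f x))) \<and>
     F = cdf (density lborel (\<lambda>x. ennreal (f x)))"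

definition left_endpoint :: "(real \<Rightarrow> real) \<Rightarrow> ereal" where
  "left_endpoint F = Inf (ereal ` {x. F x > 0})"

definition right_endpoint :: "(real \<Rightarrow> real) \<Rightarrow> ereal" where
  "right_endpoint F = Sup (ereal ` {x. F x < 1})"

definition eventually_positive :: "(real \<Rightarrow> real) \<Rightarrow> (real \<Rightarrow> real) \<Rightarrow> bool" where
  "eventually_positive F f \<longleftrightarrow>
     (\<exists>x0. ereal x0 < right_endpoint F \<and>
        (\<forall>x. x0 < x \<and> ereal x < right_endpoint F \<longrightarrow> 0 < f x))"

definition max_domain_of_attraction ::
  "(real \<Rightarrow> real) \<Rightarrow> (real \<Rightarrow> real) \<Rightarrow> (nat \<Rightarrow> real) \<Rightarrow> (nat \<Rightarrow> real) \<Rightarrow> bool" where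
  "max_domain_of_attraction F G a b \<longleftrightarrow>
     (\<forall>n\<ge>1. 0 < a n) \<and>
     (\<forall>x. isCont G x \<longrightarrow> (\<lambda>n. F (a n * x + b n) ^ n) \<longlonglongrightarrow> G x)"

text \<open>The \<^term>\<open>j\<close>-th smallest of \<open>X 1 \<omega>, \<dots>, X n \<omega>\<close>, for \<open>1 \<le> j \<le> n\<close>.\<close>

definition order_statistic :: "(nat \<Rightarrow> 'a \<Rightarrow> real) \<Rightarrow> nat \<Rightarrow> nat \<Rightarrow> 'a \<Rightarrow> real" where
  "order_statistic X j n \<omega> = sort (map (\<lambda>i. X i \<omega>) [1..<Suc n]) ! (j - 1)"

text \<open>For \<open>n \<ge> k \<ge> 1\<close> this is the density of the normalized \<open>k\<close>-th largest of \<open>n\<close> i.i.d.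
  variables with distribution function \<^term>\<open>F\<close> and density \<^term>\<open>f\<close>.\<close>

definition kth_extreme_density ::
  "(real \<Rightarrow> real) \<Rightarrow> (real \<Rightarrow> real) \<Rightarrow> (nat \<Rightarrow> real) \<Rightarrow> (nat \<Rightarrow> real) \<Rightarrow> nat \<Rightarrow> nat \<Rightarrow> real \<Rightarrow> real" where
  "kth_extreme_density F f a b k n x =
     fact n / (fact (k - 1) * fact (n - k)) * a n * f (a n * x + b n) *
     F (a n * x + b n) ^ (n - k) * (1 - F (a n * x + b n)) ^ (k - 1)"

definition frechet_df :: "real \<Rightarrow> real \<Rightarrow> real" where
  "frechet_df \<alpha> x = (if x > 0 then exp (- (x powr (- \<alpha>))) else 0)"

definition weibull_df :: "real \<Rightarrow> real \<Rightarrow> real" where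
  "weibull_df \<alpha> x = (if x < 0 then exp (- (\<bar>x\<bar> powr \<alpha>)) else 1)"

definition gumbel_df :: "real \<Rightarrow> real" where
  "gumbel_df x = exp (- exp (- x))"

definition frechet_density :: "real \<Rightarrow> nat \<Rightarrow> real \<Rightarrow> real" where
  "frechet_density \<alpha> k x =
     (if x > 0 then \<alpha> / fact (k - 1) * x powr (- \<alpha> * real k - 1) * exp (- (x powr (- \<alpha>))) else 0)"

definition weibull_density :: "real \<Rightarrow> nat \<Rightarrow> real \<Rightarrow> real" where
  "weibull_density \<alpha> k x =
     (if x < 0 then \<alpha> / fact (k - 1) * (- x) powr (\<alpha> * real k - 1) * exp (- ((- x) powr \<alpha>)) else 0)"

definition gumbel_density :: "nat \<Rightarrow> real \<Rightarrow> real" where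
  "gumbel_density k x = 1 / fact (k - 1) * exp (- real k * x) * exp (- exp (- x))"

end

theory Submission
  imports Defs
begin

text \<open>In the coordinate \<open>v = n (1 - F y)\<close> the entropy of the normalized \<open>k\<close>-th extreme is
  \<open>- \<integral> K\<^sub>n ln (n a\<^sub>n \<phi> (v/n) K\<^sub>n) dv\<close>, where \<open>K\<^sub>n\<close> is a beta density converging to the gamma
  density and \<open>\<phi> s\<close> is \<open>f\<close> at the upper \<open>s\<close>-quantile. Since \<open>f\<close> is nonincreasing, \<open>1 - F\<close> is convex
  on the interior of the support, so convergence of \<open>n (1 - F (a\<^sub>n x + b\<^sub>n))\<close> to \<open>H = - ln G\<close>
  gives convergence of its slopes: \<open>n a\<^sub>n \<phi> (v/n)\<close>
  tends to \<open>- H'\<close> at \<open>H\<^sup>-\<^sup>1 v\<close>. Monotonicity of \<open>\<phi>\<close> and this limit give a doubling estimate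
  \<open>\<phi> s \<le> C \<phi> (s/2)\<close> near 0, hence \<open>\<bar>ln (n a\<^sub>n \<phi> (v/n))\<bar> \<le> C (1 + \<bar>ln v\<bar>)\<close> for \<open>v \<le> s\<^sub>0 n\<close> and dominated
  convergence; for \<open>v > s\<^sub>0 n\<close> the kernel is exponentially small and \<open>ln \<phi>\<close> is integrable because
  the entropy of \<open>f\<close> exists.\<close>

subsection \<open>The rescaled beta and gamma kernels\<close>

text \<open>\<open>beta_kernel k n\<close> is the density on \<open>(0, n)\<close> of \<open>n (1 - F (X))\<close>, where \<open>X\<close> is the \<open>k\<close>-th
  largest of \<open>n\<close> observations with continuous distribution function \<open>F\<close>.\<close>

definition beta_kernel :: "nat \<Rightarrow> nat \<Rightarrow> real \<Rightarrow> real" where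
  "beta_kernel k n v =
     fact n / (fact (k - 1) * fact (n - k)) / real n * (v / real n) ^ (k - 1) * (1 - v / real n) ^ (n - k)"

definition gamma_kernel :: "nat \<Rightarrow> real \<Rightarrow> real" where
  "gamma_kernel k v = v ^ (k - 1) * exp (- v) / fact (k - 1)"

lemma fact_quotient_le:
  assumes "k \<le> n"
  shows "(fact n :: real) / fact (n - k) \<le> real n ^ k"
  using assms
proof (induction k)
  case (Suc k)
  have e: "(fact (n - k) :: real) = real (n - k) * fact (n - Suc k)"
    using Suc.prems by (metis Suc_diff_Suc Suc_le_lessD fact_Suc)
  have "(fact n :: real) / fact (n - Suc k) = real (n - k) * (fact n / fact (n - k))"
    using Suc.prems by (simp add: e)
  also have "\<dots> \<le> real n * real n ^ k"
    using Suc by (intro mult_mono) auto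
  finally show ?case by simp
qed auto

lemma fact_quotient_limit:
  "(\<lambda>n. (fact n :: real) / fact (n - k) / real n ^ k) \<longlonglongrightarrow> 1"
proof (induction k)
  case 0
  then show ?case by simp
next
  case (Suc k)
  have "(\<lambda>n. (fact n :: real) / fact (n - k) / real n ^ k * (1 - real k / real n)) \<longlonglongrightarrow> 1 * (1 - 0)"
    by (intro tendsto_mult Suc tendsto_diff tendsto_const lim_const_over_n)
  moreover have "\<forall>\<^sub>F n in sequentially. (fact n :: real) / fact (n - k) / real n ^ k * (1 - real k / real n)
      = (fact n :: real) / fact (n - Suc k) / real n ^ Suc k"
    using eventually_gt_at_top[of k]
  proof eventually_elim
    case (elim n)
    have e: "(fact (n - k) :: real) = (real n - real k) * fact (n - Suc k)"
      using elim by (metis Suc_diff_Suc fact_Suc less_imp_le of_nat_diff)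
    have "real n - real k \<noteq> 0" "real n \<noteq> 0" using elim by auto
    then show ?case by (simp add: e field_simps)
  qed
  ultimately show ?case
    using filterlim_cong[OF refl refl] by fastforce
qed

text \<open>The kernel factors into a falling factorial divided by n^k, a constant in n, and (1 -
  v/n)^n / (1 - v/n)^k; these tend to 1, themselves, and exp (-v) respectively.\<close>

lemma beta_kernel_limit:
  assumes "k \<ge> 1"
  shows "(\<lambda>n. beta_kernel k n v) \<longlonglongrightarrow> gamma_kernel k v"
proof -
  have 1: "(\<lambda>n. (1 - v / real n) ^ n) \<longlonglongrightarrow> exp (- v)"
    using tendsto_exp_limit_sequentially[of "- v"] by simp
  have 2: "(\<lambda>n. (1 - v / real n) ^ k) \<longlonglongrightarrow> (1 - 0) ^ k"
    by (intro tendsto_power tendsto_diff tendsto_const lim_const_over_n)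
  have 3: "(\<lambda>n. (fact n / fact (n - k) / real n ^ k) * (v ^ (k - 1) / fact (k - 1)) *
      ((1 - v / real n) ^ n / (1 - v / real n) ^ k)) \<longlonglongrightarrow> 1 * (v ^ (k - 1) / fact (k - 1)) * (exp (- v) / (1 - 0) ^ k)"
    by (intro tendsto_mult fact_quotient_limit tendsto_divide 1 2 tendsto_const) auto
  moreover have "\<forall>\<^sub>F n in sequentially. (fact n / fact (n - k) / real n ^ k) * (v ^ (k - 1) / fact (k - 1)) *
      ((1 - v / real n) ^ n / (1 - v / real n) ^ k) = beta_kernel k n v"
    \<comment> \<open>For n > |v| the base 1 - v/n is nonzero, so the exponent n - k may be written
      as a quotient of powers.\<close>
    using eventually_gt_at_top[of k] eventually_gt_at_top[of "nat \<lceil>\<bar>v\<bar>\<rceil>"]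
  proof eventually_elim
    case (elim n)
    have "1 - v / real n \<noteq> 0" using elim by (auto simp: field_simps)
    moreover have "n = (n - k) + k" "k = Suc (k - 1)" using elim assms by auto
    then have "(1 - v / real n) ^ n = (1 - v / real n) ^ (n - k) * (1 - v / real n) ^ k"
      "real n ^ k = real n * real n ^ (k - 1)"
      by (metis power_add, metis power_Suc)
    ultimately show ?case
      using elim by (simp add: beta_kernel_def power_divide)
  qed
  ultimately show ?thesis
    unfolding gamma_kernel_def using filterlim_cong[OF refl refl] by fastforce
qed

lemma beta_kernel_pos:
  assumes "0 < v" "v < real n"
  shows "0 < beta_kernel k n v"
  using assms unfolding beta_kernel_def by (intro mult_pos_pos divide_pos_pos zero_less_power) auto

lemma gamma_kernel_pos: "0 < v \<Longrightarrow> 0 < gamma_kernel k v"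
  by (simp add: gamma_kernel_def)

lemma beta_kernel_coefficient_le:
  assumes "1 \<le> k" "k \<le> n"
  shows "fact n / (fact (k - 1) * fact (n - k)) / real n \<le> real n ^ (k - 1)"
proof -
  have "fact n / (fact (k - 1) * fact (n - k)) \<le> (fact n / fact (n - k) :: real)"
    using fact_ge_1[of "k - 1", where 'a = real]
    by (intro divide_left_mono) (auto simp: mult_le_cancel_right1)
  also have "\<dots> \<le> real n ^ k" by (rule fact_quotient_le[OF assms(2)])
  also have "\<dots> = real n ^ (k - 1) * real n" using assms by (cases k) auto
  finally show ?thesis using assms by (subst pos_divide_le_eq) auto
qed

text \<open>A majorant free of n: 1 - v/n <= exp (-v/n), and 2k <= n makes the exponent n - k at
  least n/2.\<close>

lemma beta_kernel_le:
  assumes "1 \<le> k" "2 * k \<le> n" "0 < v" "v < real n"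
  shows "beta_kernel k n v \<le> v ^ (k - 1) * exp (- v / 2)"
proof -
  have "beta_kernel k n v \<le> real n ^ (k - 1) * (v / real n) ^ (k - 1) * (1 - v / real n) ^ (n - k)"
    unfolding beta_kernel_def using assms
    by (intro mult_right_mono beta_kernel_coefficient_le) auto
  also have "\<dots> = v ^ (k - 1) * (1 - v / real n) ^ (n - k)"
    using assms by (simp add: power_divide)
  also have "(1 - v / real n) ^ (n - k) \<le> exp (- v / real n) ^ (n - k)"
    using exp_ge_add_one_self[of "- v / real n"] assms by (intro power_mono) auto
  also have "\<dots> = exp (- (v * (real (n - k) / real n)))"
    by (simp add: exp_of_nat_mult[symmetric] field_simps)
  also have "\<dots> \<le> exp (- v / 2)"
  proof -
    have "1 / 2 \<le> real (n - k) / real n" using assms by (auto simp: field_simps of_nat_diff)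
    then show ?thesis using mult_left_mono[of "1/2" "real (n - k) / real n" v] assms by auto
  qed
  finally show ?thesis using assms by (simp add: mult_left_mono)
qed

text \<open>A single term of the series of exp (v/4) dominates the power, so half of the decay rate
  survives.\<close>

lemma power_exp_le:
  assumes "0 \<le> (v :: real)"
  shows "v ^ j * exp (- v / 2) \<le> 4 ^ j * fact j * exp (- v / 4)"
proof -
  have "(v / 4) ^ j /\<^sub>R fact j \<le> exp (v / 4)"
    unfolding exp_def
    using assms sum_le_suminf[OF summable_exp_generic[of "v / 4"], of "{j}"] by auto
  then have "v ^ j \<le> 4 ^ j * fact j * exp (v / 4)"
    by (simp add: field_simps power_divide)
  then have "v ^ j * exp (- v / 2) \<le> 4 ^ j * fact j * exp (v / 4) * exp (- v / 2)"
    by (rule mult_right_mono) simp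
  also have "\<dots> = 4 ^ j * fact j * exp (- v / 4)"
    by (simp add: mult.assoc exp_add[symmetric])
  finally show ?thesis .
qed

lemma abs_ln_le:
  assumes "0 < (v :: real)"
  shows "\<bar>ln v\<bar> \<le> v + 1 / v"
proof -
  have "ln v \<le> v - 1" "ln (1 / v) \<le> 1 / v - 1"
    using assms by (auto intro!: ln_le_minus_one)
  then show ?thesis using assms by (auto simp: ln_div abs_le_iff)
     (smt (verit, ccfv_SIG) divide_pos_pos)+
qed

text \<open>The right-hand side is increasing in t, unlike |t ln t|, so an upper bound on t can be
  inserted. Applying \<open>abs_ln_le\<close> to sqrt t replaces the term 1/t by 1/sqrt t, which
  still vanishes at 0 after multiplication by t.\<close>

lemma abs_mult_ln_le:
  assumes "0 < (t :: real)"
  shows "\<bar>t * ln t\<bar> \<le> 4 * (sqrt t + t\<^sup>2)"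
proof -
  have s: "0 < sqrt t" using assms by simp
  have "ln t = 2 * ln (sqrt t)" using assms by (simp add: ln_sqrt)
  then have "\<bar>t * ln t\<bar> = 2 * (t * \<bar>ln (sqrt t)\<bar>)" using assms by (simp add: abs_mult)
  also have "\<dots> \<le> 2 * (t * (sqrt t + 1 / sqrt t))"
    using abs_ln_le[OF s] assms by (intro mult_left_mono) auto
  also have "t * (sqrt t + 1 / sqrt t) = t * sqrt t + sqrt t"
    using assms by (simp add: algebra_simps real_div_sqrt)
  also have "t * sqrt t \<le> sqrt t + t\<^sup>2"
  proof (cases "t \<le> 1")
    case True
    then show ?thesis using mult_right_mono[of t 1 "sqrt t"] assms by (simp add: add_increasing2)
  next
    case False
    then have "sqrt t \<le> sqrt (t\<^sup>2)" by (intro real_sqrt_le_mono) (simp add: power2_eq_square)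
    then have "sqrt t \<le> t" using assms by simp
    then show ?thesis using mult_left_mono[of "sqrt t" t t] assms by (simp add: power2_eq_square add_increasing)
  qed
  finally show ?thesis using assms by (simp add: power2_eq_square) (smt (verit) mult_pos_pos)
qed

subsection \<open>Entropy integrals of a monotone tail\<close>

text \<open>With \<phi> s the value of f at the upper s-quantile, the integral over v is minus the
  entropy of the normalized k-th extreme (\<open>kth_extreme_density_entropy\<close>).\<close>

definition tail_entropy_integrand :: "nat \<Rightarrow> (real \<Rightarrow> real) \<Rightarrow> real \<Rightarrow> nat \<Rightarrow> real \<Rightarrow> real" where
  "tail_entropy_integrand k \<phi> a n v =
     indicator {0<..<real n} v * (beta_kernel k n v * ln (real n * a * \<phi> (v / real n) * beta_kernel k n v))"

text \<open>Used with s = 0 as a crude bound on all of (0, n), and with a fixed s > 0 to show that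
  the kernel is exponentially small for v > s n.\<close>

lemma beta_kernel_le_power:
  assumes "1 \<le> k" "k \<le> n" "0 \<le> s" "s \<le> 1" "s * real n \<le> v" "v \<le> real n"
  shows "beta_kernel k n v \<le> real n ^ (k - 1) * (1 - s) ^ (n - k)"
proof -
  have "0 \<le> s * real n" using assms by auto
  then have v: "0 \<le> v" using assms by linarith
  have n: "0 < real n" using assms by auto
  have "beta_kernel k n v \<le> real n ^ (k - 1) * (v / real n) ^ (k - 1) * (1 - v / real n) ^ (n - k)"
    unfolding beta_kernel_def using assms v n
    by (intro mult_right_mono beta_kernel_coefficient_le) auto
  also have "\<dots> \<le> real n ^ (k - 1) * 1 ^ (k - 1) * (1 - s) ^ (n - k)"
    using assms v n by (intro mult_mono power_mono mult_nonneg_nonneg zero_le_power) (auto simp: field_simps)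
  finally show ?thesis by simp
qed

lemma beta_kernel_measurable [measurable]: "beta_kernel k n \<in> borel_measurable borel"
  unfolding beta_kernel_def by measurable

text \<open>The properties of \<phi> s = f (T s) that the entropy integrals use. Since f dx becomes
  ds in the quantile coordinate, integrability of ln \<phi> on (0, 1) expresses existence of the
  entropy of f.\<close>

locale monotone_tail =
  fixes \<phi> :: "real \<Rightarrow> real"
  assumes \<phi>_pos: "\<And>s. 0 < s \<Longrightarrow> s < 1 \<Longrightarrow> 0 < \<phi> s"
    and \<phi>_mono: "\<And>s t. 0 < s \<Longrightarrow> s \<le> t \<Longrightarrow> t < 1 \<Longrightarrow> \<phi> s \<le> \<phi> t"
    and ln_\<phi>_integrable: "integrable lborel (\<lambda>s. indicator {0<..<1} s * ln (\<phi> s))"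
begin

definition L :: "real \<Rightarrow> real" where "L s = indicator {0<..<1} s * ln (\<phi> s)"

lemma L_eq: "0 < s \<Longrightarrow> s < 1 \<Longrightarrow> L s = ln (\<phi> s)"
  by (simp add: L_def)

lemma L_mono: "0 < s \<Longrightarrow> s \<le> t \<Longrightarrow> t < 1 \<Longrightarrow> L s \<le> L t"
  using \<phi>_mono[of s t] \<phi>_pos[of s] by (simp add: L_eq)

lemma L_integrable: "integrable lborel L"
  using ln_\<phi>_integrable unfolding L_def .

lemma L_measurable [measurable]: "L \<in> borel_measurable borel"
  using borel_measurable_integrable[OF L_integrable] by simp

lemma L_scaled_integrable: "0 < c \<Longrightarrow> integrable lborel (\<lambda>v. \<bar>L (v / c)\<bar>)"
  using lborel_integrable_real_affine_iff[of "1 / c" L 0] L_integrable by auto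

lemma integral_L_scaled: "0 < c \<Longrightarrow> (\<integral>v. \<bar>L (v / c)\<bar> \<partial>lborel) = c * (\<integral>s. \<bar>L s\<bar> \<partial>lborel)"
  using lborel_integral_real_affine[of "1 / c" "\<lambda>s. \<bar>L s\<bar>" 0] by (auto simp: field_simps)

lemma tail_entropy_integrand_eq:
  assumes "1 \<le> n" "0 < a"
  shows "tail_entropy_integrand k \<phi> a n v = indicator {0<..<real n} v *
     (beta_kernel k n v * (ln (real n * a) + L (v / real n)) + beta_kernel k n v * ln (beta_kernel k n v))"
proof (cases "v \<in> {0<..<real n}")
  case True
  then have s: "0 < v / real n" "v / real n < 1" by auto
  have "ln (real n * a * \<phi> (v / real n) * beta_kernel k n v)
      = ln (real n * a) + ln (\<phi> (v / real n)) + ln (beta_kernel k n v)"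
    using assms \<phi>_pos[OF s] beta_kernel_pos[of v n k] True by (simp add: ln_mult_pos)
  then show ?thesis using s by (simp add: tail_entropy_integrand_def L_eq algebra_simps)
qed (simp add: tail_entropy_integrand_def)

lemma abs_kernel_ln_le:
  assumes "0 < t" "t \<le> B"
  shows "\<bar>t * ln t\<bar> \<le> 4 * (sqrt B + B\<^sup>2)"
proof -
  have "\<bar>t * ln t\<bar> \<le> 4 * (sqrt t + t\<^sup>2)" by (rule abs_mult_ln_le[OF assms(1)])
  also have "\<dots> \<le> 4 * (sqrt B + B\<^sup>2)"
    using assms by (intro mult_left_mono add_mono power_mono real_sqrt_le_mono) auto
  finally show ?thesis .
qed

lemma tail_entropy_integrand_measurable:
  assumes "1 \<le> n" "0 < a"
  shows "tail_entropy_integrand k \<phi> a n \<in> borel_measurable borel"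
  unfolding tail_entropy_integrand_eq[OF assms] by measurable

text \<open>For a single n a crude majorant suffices: on the bounded interval (0, n) the kernel is
  at most n^(k-1), and L is integrable. This yields existence of the entropy for every n >=
  k.\<close>

lemma tail_entropy_integrand_integrable:
  assumes "1 \<le> k" "k \<le> n" "0 < a"
  shows "integrable lborel (tail_entropy_integrand k \<phi> a n)"
proof -
  define B where "B = real n ^ (k - 1)"
  have n: "1 \<le> n" "0 < real n" using assms by auto
  have B: "0 \<le> B" by (simp add: B_def)
  define h where "h v = indicator {0<..<real n} v * (B * \<bar>ln (real n * a)\<bar> + 4 * (sqrt B + B\<^sup>2)) + B * \<bar>L (v / real n)\<bar>" for v
  have "integrable lborel h"
    unfolding h_def using n
    by (intro Bochner_Integration.integrable_add integrable_mult_left integrable_mult_right L_scaled_integrable)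
      (auto simp: integrable_real_indicator)
  then show ?thesis
  proof (rule Bochner_Integration.integrable_bound)
    show "tail_entropy_integrand k \<phi> a n \<in> borel_measurable lborel"
      using tail_entropy_integrand_measurable[of n a] n assms by simp
    show "AE v in lborel. norm (tail_entropy_integrand k \<phi> a n v) \<le> norm (h v)"
    proof (intro AE_I2)
      fix v
      show "norm (tail_entropy_integrand k \<phi> a n v) \<le> norm (h v)"
      proof (cases "v \<in> {0<..<real n}")
        case True
        let ?K = "beta_kernel k n v"
        have K: "0 < ?K" "?K \<le> B"
          using True beta_kernel_pos beta_kernel_le_power[of k n 0 v] assms by (auto simp: B_def)
        have "\<bar>?K * (ln (real n * a) + L (v / real n)) + ?K * ln ?K\<bar>
          \<le> ?K * \<bar>ln (real n * a) + L (v / real n)\<bar> + \<bar>?K * ln ?K\<bar>"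
          using K by (metis abs_mult abs_of_pos abs_triangle_ineq)
        also have "\<dots> \<le> B * (\<bar>ln (real n * a)\<bar> + \<bar>L (v / real n)\<bar>) + 4 * (sqrt B + B\<^sup>2)"
          using K by (intro add_mono mult_mono abs_kernel_ln_le) auto
        finally show ?thesis
          using True n assms B by (simp add: tail_entropy_integrand_eq h_def algebra_simps)
      next
        case False
        then show ?thesis by (simp add: tail_entropy_integrand_def h_def)
      qed
    qed
  qed
qed

end

section \<open>Uniform logarithmic bounds for regular tails\<close>

locale regular_tail = monotone_tail +
  fixes a :: "nat \<Rightarrow> real" and \<gamma> :: "real \<Rightarrow> real"
  assumes a_pos: "\<And>n. 1 \<le> n \<Longrightarrow> 0 < a n"
    and limit: "\<And>v. 0 < v \<Longrightarrow> (\<lambda>n. real n * a n * \<phi> (v / real n)) \<longlonglongrightarrow> \<gamma> v"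
    and \<gamma>_pos: "\<And>v. 0 < v \<Longrightarrow> 0 < \<gamma> v"
begin

lemma ln_limit: 
  assumes "0 < v"
  shows "(\<lambda>n. ln (real n * a n) + L (v / real n)) \<longlonglongrightarrow> ln (\<gamma> v)"
proof -
  have "(\<lambda>n. ln (real n * a n * \<phi> (v / real n))) \<longlonglongrightarrow> ln (\<gamma> v)"
    using limit[OF assms] \<gamma>_pos[OF assms] by (intro tendsto_ln) auto
  moreover have "\<forall>\<^sub>F n in sequentially. ln (real n * a n * \<phi> (v / real n)) = ln (real n * a n) + L (v / real n)"
    using eventually_gt_at_top[of "nat \<lceil>\<bar>v\<bar>\<rceil>"]
  proof eventually_elim
    case (elim n)
    then have n: "1 \<le> n" "v < real n" by linarith+
    then have s: "0 < v / real n" "v / real n < 1" using assms by auto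
    show ?case using \<phi>_pos[OF s] a_pos[OF n(1)] n by (simp add: L_eq[OF s] ln_mult_pos)
  qed
  ultimately show ?thesis using filterlim_cong[OF refl refl] by fast
qed

text \<open>The limits at \<open>v = 1\<close> and \<open>v = 1/4\<close> bound \<open>\<phi> s / \<phi> (s/2)\<close> near 0 by monotonicity, which
  replaces the Potter bounds of regular variation uniformly over all three limit types.\<close>

lemma doubling:
  obtains s0 K where "0 < s0" "s0 < 1" "0 \<le> K" "\<And>s. 0 < s \<Longrightarrow> s \<le> s0 \<Longrightarrow> L s - L (s / 2) \<le> K"
proof -
  define K where "K = \<bar>ln (\<gamma> 1) - ln (\<gamma> (1 / 4))\<bar> + 1"
  \<comment> \<open>The unknown term ln (n a_n) cancels in the difference of the two limits; the + 1
    in \<open>K\<close> leaves room for a strict inequality.\<close>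
  have "(\<lambda>n. (ln (real n * a n) + L (1 / real n)) - (ln (real n * a n) + L ((1 / 4) / real n)))
      \<longlonglongrightarrow> ln (\<gamma> 1) - ln (\<gamma> (1 / 4))"
    by (intro tendsto_diff ln_limit) auto
  then have "\<forall>\<^sub>F n in sequentially. L (1 / real n) - L ((1 / 4) / real n) < K"
    by (rule order_tendstoD(2)[THEN eventually_mono]) (auto simp: K_def)
  then obtain N where N: "\<And>n. N \<le> n \<Longrightarrow> L (1 / real n) - L ((1 / 4) / real n) < K"
    by (auto simp: eventually_sequentially)
  define s0 where "s0 = 1 / real (N + 3)"
  show thesis
  proof
    show "0 < s0" "s0 < 1" "0 \<le> K" by (auto simp: s0_def K_def)
    fix s assume s: "0 < s" "s \<le> s0"
    \<comment> \<open>Then 1/(n+1) < s <= 1/n. Monotonicity replaces s by 1/n from above and s/2 by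
      1/(4n) from below; choosing 1/4 rather than 1/2 absorbs the rounding, as 1/(2n) <=
      1/(n+1).\<close>
    define n where "n = nat \<lfloor>1 / s\<rfloor>"
    have "real (N + 3) \<le> 1 / s" using s by (simp add: s0_def field_simps)
    then have n: "N + 3 \<le> n" unfolding n_def by (simp add: le_nat_floor)
    have n1: "real n \<le> 1 / s" "1 / s < real n + 1"
      using s by (auto simp: n_def)
    then have n2: "s \<le> 1 / real n" "1 / (real n + 1) < s" using s n by (auto simp: field_simps)
    have "L s \<le> L (1 / real n)" using s n n2 by (intro L_mono) auto
    moreover have "L ((1 / 4) / real n) \<le> L (s / 2)"
    proof (rule L_mono)
      have "2 * ((1 / 4) / real n) \<le> 1 / (real n + 1)" using n by (simp add: field_simps)
      also have "\<dots> \<le> s" using n2 by simp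
      finally show "(1 / 4) / real n \<le> s / 2" by simp
      show "s / 2 < 1" using s \<open>s0 < 1\<close> by simp
    qed (use n in auto)
    ultimately show "L s - L (s / 2) \<le> K" using N[of n] n by linarith
  qed
qed

text \<open>Halve t until it falls below s: this takes at most 1 + log2 (t/s) steps, each costing at
  most K. The factor 2 comes from 1 / ln 2 <= 2.\<close>

lemma potter_bound:
  assumes "s0 < 1" "0 \<le> K" and dbl: "\<And>s. 0 < s \<Longrightarrow> s \<le> s0 \<Longrightarrow> L s - L (s / 2) \<le> K"
    and "0 < s" "s \<le> t" "t \<le> s0"
  shows "L t - L s \<le> K * (1 + 2 * ln (t / s))"
proof -
  have iter: "L t - L (t / 2 ^ m) \<le> K * real m" for m
  proof (induction m)
    case (Suc m)
    have "t / 2 ^ m \<le> t" using assms by (simp add: field_simps)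
    then have "L (t / 2 ^ m) - L (t / 2 ^ m / 2) \<le> K"
      using assms by (intro dbl) auto
    then show ?case using Suc by (simp add: algebra_simps)
  qed simp
  define m where "m = nat \<lceil>log 2 (t / s)\<rceil>"
  have ts: "1 \<le> t / s" using assms by simp
  have lg: "0 \<le> log 2 (t / s)" using ts by simp
  have m: "log 2 (t / s) \<le> real m" "real m \<le> 1 + log 2 (t / s)"
    using lg by (auto simp: m_def) linarith
  have "t / s = 2 powr log 2 (t / s)" using ts by simp
  also have "\<dots> \<le> 2 powr real m" using m by (intro powr_mono) auto
  finally have "t / s \<le> 2 ^ m" by (simp add: powr_realpow)
  then have "t / 2 ^ m \<le> s" using assms by (simp add: field_simps)
  then have "L (t / 2 ^ m) \<le> L s" using assms by (intro L_mono) auto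
  moreover have "log 2 (t / s) \<le> 2 * ln (t / s)"
  proof -
    have "1 / 2 \<le> ln (2::real)" using ln2_ge_two_thirds by simp
    then have "ln (t / s) / ln 2 \<le> ln (t / s) / (1 / 2)"
      using ts by (intro divide_left_mono) auto
    then show ?thesis by (simp add: log_def)
  qed
  then have "K * real m \<le> K * (1 + 2 * ln (t / s))"
    using m assms by (intro mult_left_mono) auto
  ultimately show ?thesis using iter[of m] by linarith
qed

text \<open>At v = 1 the quantity converges, hence is bounded for large n, and the Potter bound
  carries it from 1/n to v/n at a cost linear in |ln v|. The second bound serves v > s0 n, where the
  term with L is split off and ln (n a_n) stands alone; there L (1/n) is compared with the constant
  L s0.\<close>

lemma uniform_bound:
  obtains s0 C N where "0 < s0" "s0 < 1" "0 \<le> C"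
    "\<And>n v. N \<le> n \<Longrightarrow> 0 < v \<Longrightarrow> v \<le> s0 * real n \<Longrightarrow> \<bar>ln (real n * a n) + L (v / real n)\<bar> \<le> C * (1 + \<bar>ln v\<bar>)"
    "\<And>n v. N \<le> n \<Longrightarrow> s0 * real n < v \<Longrightarrow> \<bar>ln (real n * a n)\<bar> \<le> C * (1 + \<bar>ln v\<bar>)"
proof -
  obtain s0 K where s0: "0 < s0" "s0 < 1" "0 \<le> K" and dbl: "\<And>s. 0 < s \<Longrightarrow> s \<le> s0 \<Longrightarrow> L s - L (s / 2) \<le> K"
    using doubling by blast
  have potter: "L t - L s \<le> K * (1 + 2 * ln (t / s))" if "0 < s" "s \<le> t" "t \<le> s0" for s t
    using potter_bound[of s0 K s t] s0 dbl that by blast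
  have "\<forall>\<^sub>F n in sequentially. dist (ln (real n * a n) + L (1 / real n)) (ln (\<gamma> 1)) < 1"
    using tendstoD[OF ln_limit[of 1], of 1] by simp
  then obtain N1 where N1: "\<And>n. N1 \<le> n \<Longrightarrow> dist (ln (real n * a n) + L (1 / real n)) (ln (\<gamma> 1)) < 1"
    by (auto simp: eventually_sequentially)
  \<comment> \<open>The ceiling puts 1/n below s0, so that the Potter bound applies at 1/n; the + 1
    keeps n positive.\<close>
  define N where "N = N1 + nat \<lceil>1 / s0\<rceil> + 1"
  define A where "A = \<bar>ln (\<gamma> 1)\<bar> + 1"
  define C where "C = A + \<bar>L s0\<bar> + 2 * K"
  have mid: "\<bar>ln (real n * a n) + L (1 / real n)\<bar> \<le> A" "0 < 1 / real n" "1 / real n \<le> s0" "0 < real n" if "N \<le> n" for n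
  proof -
    show "0 < 1 / real n" "0 < real n" using that by (auto simp: N_def)
    show "\<bar>ln (real n * a n) + L (1 / real n)\<bar> \<le> A"
      using N1[of n] that by (auto simp: N_def A_def dist_real_def)
    have "1 / s0 \<le> real n" using that unfolding N_def by linarith
    then show "1 / real n \<le> s0" using s0 \<open>0 < real n\<close> by (simp add: field_simps)
  qed
  have C: "0 \<le> C" "A + K \<le> C" "2 * K \<le> C" "A + \<bar>L s0\<bar> + K \<le> C"
    using s0 by (auto simp: C_def A_def)
  show thesis
  proof (rule that[OF s0(1,2) C(1)])
    fix n v assume n: "N \<le> n" and v: "0 < v" "v \<le> s0 * real n"
    note m = mid[OF n]
    have vs: "0 < v / real n" "v / real n \<le> s0" using v m by (auto simp: field_simps)
    have "\<bar>L (v / real n) - L (1 / real n)\<bar> \<le> K * (1 + 2 * \<bar>ln v\<bar>)"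
    proof (cases "1 \<le> v")
      case True
      then have le: "1 / real n \<le> v / real n" using m by (simp add: field_simps)
      show ?thesis
        using potter[OF m(2) le vs(2)] L_mono[OF m(2) le order.strict_trans1[OF vs(2) s0(2)]] m True by auto
    next
      case False
      then have le: "v / real n \<le> 1 / real n" using m by (simp add: field_simps)
      have "1 / real n / (v / real n) = 1 / v" using m v by (simp add: field_simps)
      then have "ln (1 / real n / (v / real n)) = \<bar>ln v\<bar>"
        using v False by (simp add: ln_div)
      then show ?thesis
        using potter[OF vs(1) le m(3)] L_mono[OF vs(1) le order.strict_trans1[OF m(3) s0(2)]] m by auto
    qed
    then have "\<bar>ln (real n * a n) + L (v / real n)\<bar> \<le> A + K * (1 + 2 * \<bar>ln v\<bar>)"
      using m by linarith
    also have "\<dots> = (A + K) + 2 * K * \<bar>ln v\<bar>" by (simp add: algebra_simps)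
    also have "\<dots> \<le> C + C * \<bar>ln v\<bar>" using C by (intro add_mono mult_right_mono) auto
    finally show "\<bar>ln (real n * a n) + L (v / real n)\<bar> \<le> C * (1 + \<bar>ln v\<bar>)"
      by (simp add: algebra_simps)
  next
    fix n v assume n: "N \<le> n" and v: "s0 * real n < v"
    note m = mid[OF n]
    \<comment> \<open>From 1 <= s0 n < v follows ln (s0 n) <= |ln v|, which turns the cost of going
      from 1/n to s0 into one in terms of v.\<close>
    have ge: "1 \<le> s0 * real n" using m by (simp add: field_simps)
    have "L s0 - L (1 / real n) \<le> K * (1 + 2 * ln (s0 * real n))"
      using potter[OF m(2,3) order_refl] by simp
    also have "\<dots> \<le> K * (1 + 2 * \<bar>ln v\<bar>)"
      using v ge s0 by (intro mult_left_mono) auto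
    finally have "\<bar>L (1 / real n)\<bar> \<le> \<bar>L s0\<bar> + K * (1 + 2 * \<bar>ln v\<bar>)"
      using L_mono[OF m(2,3) s0(2)] s0 by linarith
    then have "\<bar>ln (real n * a n)\<bar> \<le> A + (\<bar>L s0\<bar> + K * (1 + 2 * \<bar>ln v\<bar>))"
      using m by linarith
    also have "\<dots> = (A + \<bar>L s0\<bar> + K) + 2 * K * \<bar>ln v\<bar>" by (simp add: algebra_simps)
    also have "\<dots> \<le> C + C * \<bar>ln v\<bar>" using C by (intro add_mono mult_right_mono) auto
    finally show "\<bar>ln (real n * a n)\<bar> \<le> C * (1 + \<bar>ln v\<bar>)"
      by (simp add: algebra_simps)
  qed
qed

end

section \<open>Exponential majorants and dominated convergence\<close>

lemma abs_kernel_ln_exp_le: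
  fixes K C v :: real
  assumes "0 < K" "K \<le> C * exp (- v / 4)" "0 \<le> v" "1 \<le> C"
  shows "\<bar>K * ln K\<bar> \<le> 8 * C\<^sup>2 * exp (- v / 8)"
proof -
  have "C \<le> C ^ 4" using assms(4) by (intro self_le_power) auto
  then have CC: "sqrt C \<le> C\<^sup>2" by (intro real_le_lsqrt) auto
  have "\<bar>K * ln K\<bar> \<le> 4 * (sqrt K + K\<^sup>2)" by (rule abs_mult_ln_le[OF assms(1)])
  also have "\<dots> \<le> 4 * (sqrt (C * exp (- v / 4)) + (C * exp (- v / 4))\<^sup>2)"
    using assms by (intro mult_left_mono add_mono power_mono real_sqrt_le_mono) auto
  \<comment> \<open>The square root halves the decay rate, which is where the final exp (-v/8) comes
    from.\<close>
  also have "sqrt (C * exp (- v / 4)) = sqrt C * exp (- v / 8)"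
    by (rule real_sqrt_unique) (use assms in \<open>auto simp: power_mult_distrib exp_double[symmetric]\<close>)
  also have "(C * exp (- v / 4))\<^sup>2 = C\<^sup>2 * exp (- v / 2)"
    by (auto simp: power_mult_distrib exp_double[symmetric])
  also have "4 * (sqrt C * exp (- v / 8) + C\<^sup>2 * exp (- v / 2)) \<le> 4 * (C\<^sup>2 * exp (- v / 8) + C\<^sup>2 * exp (- v / 8))"
    using assms CC by (intro mult_left_mono add_mono mult_right_mono) auto
  finally show ?thesis by simp
qed

text \<open>Up to the factor c and the value at 0, this is the exponential density, which has total
  mass 1.\<close>

lemma integrable_exp_Ioi:
  assumes "0 < (c :: real)"
  shows "integrable lborel (\<lambda>v. indicator {0<..} v * exp (- (c * v)))"
proof -
  interpret prob_space "density lborel (exponential_density c)"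
    using assms by (rule prob_space_exponential_density)
  have "integrable (density lborel (exponential_density c)) (\<lambda>v. 1 :: real)" by simp
  then have "integrable lborel (\<lambda>v. exponential_density c v *\<^sub>R (1 :: real))"
    by (subst (asm) integrable_density) (auto simp: exponential_density_nonneg assms)
  then have "integrable lborel (\<lambda>v. exponential_density c v * indicator {0<..} v / c)"
    by (intro integrable_divide integrable_real_mult_indicator) auto
  moreover have "(\<lambda>v. exponential_density c v * indicator {0<..} v / c) = (\<lambda>v. indicator {0<..} v * exp (- (c * v)))"
    using assms by (auto simp: fun_eq_iff exponential_density_def indicator_def)
  ultimately show ?thesis by simp
qed

text \<open>Here k >= 2 enters: |ln v| <= v + 1/v produces the powers k - 1, k and k - 2 of v, all
  nonnegative. The factor 3 counts these three terms.\<close>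

lemma kernel_weight_le:
  fixes K v :: real and k :: nat
  assumes "2 \<le> k" "0 < v" "0 \<le> K" "K \<le> v ^ (k - 1) * exp (- v / 2)"
  defines "C \<equiv> 3 * (4 ^ k * fact k)"
  shows "K \<le> C * exp (- v / 4)" "K * (1 + \<bar>ln v\<bar>) \<le> C * exp (- v / 4)" "1 \<le> C"
proof -
  have mono: "v ^ j * exp (- v / 2) \<le> 4 ^ k * fact k * exp (- v / 4)" if "j \<le> k" for j
  proof -
    have "v ^ j * exp (- v / 2) \<le> 4 ^ j * fact j * exp (- v / 4)"
      using assms by (intro power_exp_le) auto
    also have "\<dots> \<le> 4 ^ k * fact k * exp (- v / 4)"
      using that by (intro mult_right_mono mult_mono power_increasing fact_mono) auto
    finally show ?thesis .
  qed
  obtain m where k: "k = Suc (Suc m)" using assms(1) by (metis Suc_le_D numeral_2_eq_2 Suc_le_mono)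
  have "K * (1 + \<bar>ln v\<bar>) \<le> (v ^ (k - 1) * exp (- v / 2)) * (1 + (v + 1 / v))"
    using assms abs_ln_le[of v] by (intro mult_mono) auto
  also have "\<dots> = v ^ (k - 1) * exp (- v / 2) + v ^ k * exp (- v / 2) + v ^ (k - 2) * exp (- v / 2)"
    using assms by (simp add: k field_simps)
  also have "\<dots> \<le> C * exp (- v / 4)"
    using mono[of "k - 1"] mono[of k] mono[of "k - 2"] by (simp add: C_def)
  finally show 2: "K * (1 + \<bar>ln v\<bar>) \<le> C * exp (- v / 4)" .
  have "K * 1 \<le> K * (1 + \<bar>ln v\<bar>)" using assms by (intro mult_left_mono) auto
  then show "K \<le> C * exp (- v / 4)" using 2 by simp
  have "(1::real) * (1 * 1) \<le> 3 * (4 ^ k * fact k)"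
    by (intro mult_mono one_le_power) auto
  then show "1 \<le> C" by (simp add: C_def)
qed

lemma power_mult_exponential_tendsto_0:
  fixes q :: real
  assumes "0 < q" "q < 1"
  shows "(\<lambda>n. real n ^ k * q ^ (n - k)) \<longlonglongrightarrow> 0"
proof -
  define c where "c = - ln q"
  have c: "0 < c" using assms by (simp add: c_def)
  have "filterlim (\<lambda>n. c * real n) at_top sequentially"
    using c by (intro filterlim_tendsto_pos_mult_at_top[OF tendsto_const _ filterlim_real_sequentially])
  then have "(\<lambda>n. (c * real n) ^ k / exp (c * real n)) \<longlonglongrightarrow> 0"
    by (rule filterlim_compose[OF tendsto_power_div_exp_0])
  then have "(\<lambda>n. (c * real n) ^ k / exp (c * real n) / (c ^ k * q ^ k)) \<longlonglongrightarrow> 0 / (c ^ k * q ^ k)"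
    using c assms by (intro tendsto_divide tendsto_const) auto
  moreover have "\<forall>\<^sub>F n in sequentially. (c * real n) ^ k / exp (c * real n) / (c ^ k * q ^ k) = real n ^ k * q ^ (n - k)"
    using eventually_ge_at_top[of k]
  proof eventually_elim
    case (elim n)
    have "exp (c * real n) = 1 / q ^ n"
      using assms by (simp add: c_def exp_minus exp_of_nat2_mult field_simps ln_realpow[symmetric])
    moreover have "q ^ n = q ^ (n - k) * q ^ k" using elim by (metis power_add le_add_diff_inverse2)
    ultimately show ?case using c assms by (simp add: power_mult_distrib)
  qed
  ultimately show ?thesis using filterlim_cong[OF refl refl] by fastforce
qed

context regular_tail
begin

lemma tail_entropy_limit:
  assumes k: "2 \<le> k"
  shows "integrable lborel (\<lambda>v. indicator {0<..} v * (gamma_kernel k v * ln (\<gamma> v * gamma_kernel k v)))"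
    and "(\<lambda>n. \<integral>v. tail_entropy_integrand k \<phi> (a n) n v \<partial>lborel) \<longlonglongrightarrow>
      (\<integral>v. indicator {0<..} v * (gamma_kernel k v * ln (\<gamma> v * gamma_kernel k v)) \<partial>lborel)"
proof -
  let ?g = "\<lambda>v. indicator {0<..} v * (gamma_kernel k v * ln (\<gamma> v * gamma_kernel k v))"
  obtain s0 C N where s0: "0 < s0" "s0 < 1" and C: "0 \<le> C"
    and b1: "\<And>n v. N \<le> n \<Longrightarrow> 0 < v \<Longrightarrow> v \<le> s0 * real n \<Longrightarrow> \<bar>ln (real n * a n) + L (v / real n)\<bar> \<le> C * (1 + \<bar>ln v\<bar>)"
    and b2: "\<And>n v. N \<le> n \<Longrightarrow> s0 * real n < v \<Longrightarrow> \<bar>ln (real n * a n)\<bar> \<le> C * (1 + \<bar>ln v\<bar>)"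
    using uniform_bound by blast
  \<comment> \<open>\<open>P\<close> is dominated; \<open>R\<close> is the part where \<open>1 - F > s0\<close>, which has exponentially small mass.\<close>
  define P where "P n v = indicator {0<..<real n} v * (beta_kernel k n v *
      (ln (real n * a n) + indicator {..s0 * real n} v * L (v / real n)) + beta_kernel k n v * ln (beta_kernel k n v))" for n v
  define R where "R n v = indicator {s0 * real n<..<real n} v * (beta_kernel k n v * L (v / real n))" for n v
  \<comment> \<open>From \<open>M\<close> on both \<open>uniform_bound\<close> and
    \<open>beta_kernel_le\<close> apply; sequences are shifted by \<open>M\<close> below because
    domination is only available there.\<close>
  define M where "M = max N (2 * k)"
  have [measurable]: "P n \<in> borel_measurable borel" "R n \<in> borel_measurable borel" for n
    unfolding P_def[abs_def] R_def[abs_def] by measurable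
  have split: "tail_entropy_integrand k \<phi> (a n) n v = P n v + R n v" if "M \<le> n" for n v
  proof -
    have n: "1 \<le> n" using that k by (simp add: M_def)
    have "0 < s0 * real n" using s0 n by simp
    then show ?thesis using n a_pos[OF n]
      by (auto simp: tail_entropy_integrand_eq P_def R_def indicator_def algebra_simps)
  qed
  have pw: "(\<lambda>n. tail_entropy_integrand k \<phi> (a n) n v) \<longlonglongrightarrow> ?g v" for v
  proof (cases "0 < v")
    case True
    have "(\<lambda>n. beta_kernel k n v * (ln (real n * a n) + L (v / real n)) + beta_kernel k n v * ln (beta_kernel k n v))
      \<longlonglongrightarrow> gamma_kernel k v * ln (\<gamma> v) + gamma_kernel k v * ln (gamma_kernel k v)"
      using k gamma_kernel_pos[OF True, of k]
      by (intro tendsto_add tendsto_mult tendsto_ln beta_kernel_limit ln_limit True) auto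
    moreover have "\<forall>\<^sub>F n in sequentially. beta_kernel k n v * (ln (real n * a n) + L (v / real n)) + beta_kernel k n v * ln (beta_kernel k n v)
       = tail_entropy_integrand k \<phi> (a n) n v"
      using eventually_gt_at_top[of "nat \<lceil>\<bar>v\<bar>\<rceil>"]
    proof eventually_elim
      case (elim n)
      then have n: "1 \<le> n" "v < real n" by linarith+
      then show ?case using True a_pos by (simp add: tail_entropy_integrand_eq)
    qed
    moreover have "gamma_kernel k v * ln (\<gamma> v) + gamma_kernel k v * ln (gamma_kernel k v) = ?g v"
      using True \<gamma>_pos[OF True] gamma_kernel_pos[OF True, of k] by (simp add: ln_mult_pos algebra_simps)
    ultimately show ?thesis using filterlim_cong[OF refl refl] by fastforce
  qed (simp add: tail_entropy_integrand_def)
  \<comment> \<open>No measurability of \<gamma> is assumed; the limit integrand inherits it as a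
    pointwise limit. The shift by \<open>Suc\<close> meets the condition n >= 1 for measurability of
    the terms.\<close>
  have g_meas [measurable]: "?g \<in> borel_measurable lborel"
    by (rule borel_measurable_LIMSEQ_real[where u = "\<lambda>n. tail_entropy_integrand k \<phi> (a (Suc n)) (Suc n)"])
      (use LIMSEQ_Suc[OF pw] a_pos tail_entropy_integrand_measurable in auto)
  define C1 where "C1 = 3 * (4 ^ k * fact k :: real)"
  define C2 where "C2 = C * C1 + 8 * C1\<^sup>2"
  have dom: "norm (P n v) \<le> C2 * (indicator {0<..} v * exp (- (1 / 8 * v)))" if n: "M \<le> n" for n v
  proof (cases "v \<in> {0<..<real n}")
    case True
    let ?K = "beta_kernel k n v"
    have K: "0 < ?K" "?K \<le> v ^ (k - 1) * exp (- v / 2)"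
      using True n k beta_kernel_pos[of v n k] beta_kernel_le[of k n v] by (auto simp: M_def)
    have w: "?K \<le> C1 * exp (- v / 4)" "?K * (1 + \<bar>ln v\<bar>) \<le> C1 * exp (- v / 4)" "1 \<le> C1"
      using kernel_weight_le[OF k _ _ K(2)] K True by (auto simp: C1_def)
    let ?\<Lambda> = "ln (real n * a n) + indicator {..s0 * real n} v * L (v / real n)"
    have "\<bar>?\<Lambda>\<bar> \<le> C * (1 + \<bar>ln v\<bar>)"
      using b1[of n v] b2[of n v] True n by (cases "v \<le> s0 * real n") (auto simp: M_def)
    then have "\<bar>?K * ?\<Lambda>\<bar> \<le> ?K * (C * (1 + \<bar>ln v\<bar>))"
      using K by (simp add: abs_mult)
    also have "\<dots> = C * (?K * (1 + \<bar>ln v\<bar>))" by simp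
    also have "\<dots> \<le> C * (C1 * exp (- v / 4))" using w C by (intro mult_left_mono) auto
    also have "\<dots> \<le> C * (C1 * exp (- v / 8))" using w C True by (intro mult_left_mono) auto
    finally have "\<bar>?K * ?\<Lambda>\<bar> \<le> C * C1 * exp (- v / 8)" by simp
    moreover have "\<bar>?K * ln ?K\<bar> \<le> 8 * C1\<^sup>2 * exp (- v / 8)"
      using K w True by (intro abs_kernel_ln_exp_le) auto
    ultimately have "\<bar>?K * ?\<Lambda> + ?K * ln ?K\<bar> \<le> C2 * exp (- v / 8)"
      unfolding C2_def distrib_right by linarith
    then show ?thesis using True by (simp add: P_def)
  next
    case False
    have "0 \<le> C2" using C by (simp add: C2_def C1_def)
    then show ?thesis using False by (auto simp: P_def)
  qed
  have dom_int: "integrable lborel (\<lambda>v. C2 * (indicator {0<..} v * exp (- (1 / 8 * v))))"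
    by (intro integrable_mult_right integrable_exp_Ioi) simp
  have pwP: "(\<lambda>n. P (n + M) v) \<longlonglongrightarrow> ?g v" for v
  proof -
    \<comment> \<open>For fixed v and n > |v| / s0 the point v lies below s0 n, so R vanishes there
      and P has the same pointwise limit as the full integrand.\<close>
    have "\<forall>\<^sub>F n in sequentially. tail_entropy_integrand k \<phi> (a n) n v = P n v"
      using eventually_ge_at_top[of M] eventually_gt_at_top[of "nat \<lceil>\<bar>v\<bar> / s0\<rceil>"]
    proof eventually_elim
      case (elim n)
      then have "\<bar>v\<bar> / s0 < real n" by linarith
      then have "v < s0 * real n" using s0 by (simp add: field_simps)
      then show ?case using split elim by (simp add: R_def)
    qed
    then have "(\<lambda>n. P n v) \<longlonglongrightarrow> ?g v" 
      using pw[of v] by (rule Lim_transform_eventually[rotated])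
    then show ?thesis by (rule LIMSEQ_ignore_initial_segment)
  qed
  have P_int: "integrable lborel (P (n + M))" for n
    by (rule Bochner_Integration.integrable_bound[OF dom_int]) (auto simp only: real_norm_def intro!: AE_I2 order.trans[OF dom[unfolded real_norm_def]] abs_ge_self, simp_all)
  show "integrable lborel ?g"
    by (rule integrable_dominated_convergence[OF g_meas _ dom_int, where s = "\<lambda>n. P (n + M)"])
      (use pwP dom in auto)
  have limP: "(\<lambda>n. \<integral>v. P (n + M) v \<partial>lborel) \<longlonglongrightarrow> (\<integral>v. ?g v \<partial>lborel)"
    by (rule integral_dominated_convergence[OF g_meas _ dom_int])
      (use pwP dom in auto)
  \<comment> \<open>On v > s0 n only integrability of L is available. The kernel is at most
    \<open>B n\<close> there, and the scaling v = n s contributes a factor n, so the integral of R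
    is at most n^k (1 - s0)^(n-k) times the integral of |L|.\<close>
  define B where "B n = real n ^ (k - 1) * (1 - s0) ^ (n - k)" for n
  have bndR: "norm (R n v) \<le> B n * \<bar>L (v / real n)\<bar>" if n: "M \<le> n" for n v
  proof (cases "v \<in> {s0 * real n<..<real n}")
    case True
    have "0 < s0 * real n" using s0 n k by (simp add: M_def)
    then have "0 < v" using True by auto
    then have "0 < beta_kernel k n v" "beta_kernel k n v \<le> B n"
      using True n k s0 beta_kernel_pos[of v n k] beta_kernel_le_power[of k n s0 v] by (auto simp: M_def B_def)
    then show ?thesis using True by (simp add: R_def abs_mult mult_right_mono)
  next
    case False
    then show ?thesis using s0 by (auto simp: R_def B_def)
  qed
  have BL_int: "integrable lborel (\<lambda>v. B n * \<bar>L (v / real n)\<bar>)" if "M \<le> n" for n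
    using that k by (intro integrable_mult_right L_scaled_integrable) (auto simp: M_def)
  have R_int: "integrable lborel (R n)" if n: "M \<le> n" for n
    by (rule Bochner_Integration.integrable_bound[OF BL_int[OF n]]) (auto simp only: real_norm_def intro!: AE_I2 order.trans[OF bndR[OF n, unfolded real_norm_def]] abs_ge_self, simp_all)
  have "(\<lambda>n. \<integral>v. R n v \<partial>lborel) \<longlonglongrightarrow> 0"
  proof (rule Lim_null_comparison)
    show "\<forall>\<^sub>F n in sequentially. norm (\<integral>v. R n v \<partial>lborel) \<le> (real n ^ k * (1 - s0) ^ (n - k)) * (\<integral>s. \<bar>L s\<bar> \<partial>lborel)"
      using eventually_ge_at_top[of M]
    proof eventually_elim
      case (elim n)
      have "norm (\<integral>v. R n v \<partial>lborel) \<le> (\<integral>v. B n * \<bar>L (v / real n)\<bar> \<partial>lborel)"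
        by (rule Bochner_Integration.integral_norm_bound_integral[OF R_int[OF elim] BL_int[OF elim]]) (rule bndR[OF elim])
      also have "\<dots> = B n * (real n * (\<integral>s. \<bar>L s\<bar> \<partial>lborel))"
        using elim k by (simp add: integral_L_scaled M_def)
      also have "real n ^ k = real n ^ (k - 1) * real n" using k by (cases k) auto
      then have "B n * (real n * (\<integral>s. \<bar>L s\<bar> \<partial>lborel)) = (real n ^ k * (1 - s0) ^ (n - k)) * (\<integral>s. \<bar>L s\<bar> \<partial>lborel)"
        by (simp add: B_def)
      finally show ?case .
    qed
    show "(\<lambda>n. (real n ^ k * (1 - s0) ^ (n - k)) * (\<integral>s. \<bar>L s\<bar> \<partial>lborel)) \<longlonglongrightarrow> 0"
      using power_mult_exponential_tendsto_0[of "1 - s0" k] s0 by (intro tendsto_mult_left_zero) auto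
  qed
  then have limR: "(\<lambda>n. \<integral>v. R (n + M) v \<partial>lborel) \<longlonglongrightarrow> 0"
    by (rule LIMSEQ_ignore_initial_segment)
  have "(\<lambda>n. \<integral>v. tail_entropy_integrand k \<phi> (a (n + M)) (n + M) v \<partial>lborel) \<longlonglongrightarrow> (\<integral>v. ?g v \<partial>lborel)"
    using tendsto_add[OF limP limR] by (simp add: split P_int R_int)
  then show "(\<lambda>n. \<integral>v. tail_entropy_integrand k \<phi> (a n) n v \<partial>lborel) \<longlonglongrightarrow> (\<integral>v. ?g v \<partial>lborel)"
    by (rule LIMSEQ_offset)
qed

end

subsection \<open>The density in the quantile coordinate\<close>

lemma entropy_exists_iff:
  assumes "\<And>x. 0 \<le> p x"
  shows "entropy_exists p \<longleftrightarrow> integrable lborel (\<lambda>x. p x * ln (p x))"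
proof -
  have "(\<lambda>x. indicator {x. 0 < p x} x *\<^sub>R (p x * ln (p x))) = (\<lambda>x. p x * ln (p x))"
    using assms by (auto simp: fun_eq_iff indicator_def not_less intro: antisym)
  then show ?thesis unfolding entropy_exists_def set_integrable_def by simp
qed

lemma diff_entropy_eq:
  assumes "\<And>x. 0 \<le> p x"
  shows "diff_entropy p = - (\<integral>x. p x * ln (p x) \<partial>lborel)"
proof -
  have "(\<lambda>x. indicator {x. 0 < p x} x *\<^sub>R (p x * ln (p x))) = (\<lambda>x. p x * ln (p x))"
    using assms by (auto simp: fun_eq_iff indicator_def not_less intro: antisym)
  then show ?thesis unfolding diff_entropy_def set_lebesgue_integral_def by simp
qed

lemma eventually_at_left_real_ex:
  fixes x :: real
  assumes "\<forall>\<^sub>F y in at_left x. P y"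
  shows "\<exists>y<x. P y"
  using assms dense unfolding eventually_at_left_field by metis

lemma eventually_at_right_real_ex:
  fixes x :: real
  assumes "\<forall>\<^sub>F y in at_right x. P y"
  shows "\<exists>y>x. P y"
  using assms dense unfolding eventually_at_right_field by metis

locale cdf_with_pdf =
  fixes F f :: "real \<Rightarrow> real"
  assumes pdf: "has_pdf F f"
begin

definition D :: "real measure" where "D = density lborel (\<lambda>x. ennreal (f x))"

text \<open>The upper s-quantile, written as the pseudo-inverse \<open>D.I\<close> at 1 - s.\<close>

definition T :: "real \<Rightarrow> real" where "T s = Inf {x. 1 - s \<le> F x}"

lemma f_measurable [measurable]: "f \<in> borel_measurable borel"
  and f_nonneg: "0 \<le> f x"
  and F_eq: "F = cdf D"
  using pdf by (auto simp: has_pdf_def D_def)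

sublocale D: cdf_distribution D
proof -
  interpret prob_space D using pdf by (simp add: has_pdf_def D_def)
  show "cdf_distribution D" by unfold_locales (simp_all add: D_def)
qed

lemma F_measurable [measurable]: "F \<in> borel_measurable borel"
  unfolding F_eq by (rule D.measurable_C)

lemma F_mono: "x \<le> y \<Longrightarrow> F x \<le> F y"
  unfolding F_eq by (rule D.cdf_nondecreasing)

lemma F_nonneg: "0 \<le> F x" and F_le_1: "F x \<le> 1"
  unfolding F_eq by (simp_all add: D.cdf_nonneg D.cdf_bounded_prob)

lemma F_cont: "isCont F x"
proof -
  have "emeasure D {x} = (\<integral>\<^sup>+y. ennreal (f y) * indicator {x} y \<partial>lborel)"
    unfolding D_def by (rule emeasure_density) auto
  also have "\<dots> = 0"
    by (subst nn_integral_0_iff_AE) (auto intro!: AE_I[of _ _ "{x}"] simp: indicator_def)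
  finally show ?thesis unfolding F_eq D.isCont_cdf by (simp add: measure_def)
qed

lemma T_le_iff: "0 < s \<Longrightarrow> s < 1 \<Longrightarrow> T s \<le> x \<longleftrightarrow> 1 - s \<le> F x"
  using D.pseudoinverse[of "1 - s" x] unfolding F_eq[symmetric] T_def by simp

text \<open>Equality comes from continuity: F stays below 1 - s to the left of T s.\<close>

lemma F_T:
  assumes "0 < s" "s < 1"
  shows "F (T s) = 1 - s"
proof (rule antisym)
  have "(F \<longlongrightarrow> F (T s)) (at_left (T s))"
    using F_cont[of "T s"] by (simp add: isCont_def filterlim_at_split)
  moreover have "\<forall>\<^sub>F x in at_left (T s). F x \<le> 1 - s"
    unfolding eventually_at_filter using T_le_iff[OF assms]
    by (intro always_eventually allI impI) (use linear in \<open>fastforce simp: not_le[symmetric]\<close>)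
  ultimately show "F (T s) \<le> 1 - s"
    by (rule tendsto_upperbound) simp
  show "1 - s \<le> F (T s)" using T_le_iff[OF assms, of "T s"] by simp
qed

text \<open>Quantile transform: \<open>D.I\<close> maps the uniform law on (0, 1) to
  \<open>D\<close>, so integrating f w amounts to integrating w over quantiles. The reflection u = 1
  - s passes to upper quantiles.\<close>

lemma transport:
  fixes w :: "real \<Rightarrow> real"
  assumes w [measurable]: "w \<in> borel_measurable borel"
  shows "integrable lborel (\<lambda>x. f x * w x) \<longleftrightarrow> integrable lborel (\<lambda>s. indicator {0<..<1} s * w (T s))"
    and "(\<integral>x. f x * w x \<partial>lborel) = (\<integral>s. indicator {0<..<1} s * w (T s) \<partial>lborel)"
proof -
  let ?R = "restrict_space lborel {0<..<1::real}"
  have I: "D.I \<in> ?R \<rightarrow>\<^sub>M borel"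
    using D.measurable_CI by (simp add: measurable_def space_restrict_space sets_restrict_space)
  \<comment> \<open>Written in the form t + c s required by the affine substitution rules, with t =
    1 and c = -1.\<close>
  have e: "indicator {0<..<1} (1 + - 1 * s) * w (D.I (1 + - 1 * s)) = indicator {0<..<1} s * w (T s)" for s :: real
    by (auto simp: indicator_def T_def F_eq[symmetric])
  have "integrable lborel (\<lambda>x. f x * w x) \<longleftrightarrow> integrable D w"
    unfolding D_def using f_nonneg by (subst integrable_density) auto
  also have "\<dots> \<longleftrightarrow> integrable (distr ?R borel D.I) w" by (simp only: D.distr_I_eq_M)
  also have "\<dots> \<longleftrightarrow> integrable ?R (\<lambda>u. w (D.I u))" by (intro integrable_distr_eq I w)
  also have "\<dots> \<longleftrightarrow> integrable lborel (\<lambda>u. indicator {0<..<1} u * w (D.I u))"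
    by (subst integrable_restrict_space) auto
  also have "\<dots> \<longleftrightarrow> integrable lborel (\<lambda>s. indicator {0<..<1} s * w (T s))"
    unfolding e[symmetric]
    by (rule lborel_integrable_real_affine_iff[of "- 1" "\<lambda>u. indicator {0<..<1} u * w (D.I u)" 1, symmetric]) simp
  finally show "integrable lborel (\<lambda>x. f x * w x) \<longleftrightarrow> integrable lborel (\<lambda>s. indicator {0<..<1} s * w (T s))" .
  have "(\<integral>x. f x * w x \<partial>lborel) = integral\<^sup>L D w"
    unfolding D_def using f_nonneg by (subst integral_density) auto
  also have "\<dots> = integral\<^sup>L (distr ?R borel D.I) w" by (simp only: D.distr_I_eq_M)
  also have "\<dots> = (\<integral>u. w (D.I u) \<partial>?R)" by (intro integral_distr I w)
  also have "\<dots> = (\<integral>u. indicator {0<..<1} u * w (D.I u) \<partial>lborel)"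
    by (subst integral_restrict_space) auto
  also have "\<dots> = (\<integral>s. indicator {0<..<1} s * w (T s) \<partial>lborel)"
    unfolding e[symmetric]
    using lborel_integral_real_affine[of "- 1" "\<lambda>u. indicator {0<..<1} u * w (D.I u)" 1] by simp
  finally show "(\<integral>x. f x * w x \<partial>lborel) = (\<integral>s. indicator {0<..<1} s * w (T s) \<partial>lborel)" .
qed

lemma kth_extreme_density_eq:
  assumes "1 \<le> n"
  shows "kth_extreme_density F f a b k n x =
    real n * a n * f (a n * x + b n) * beta_kernel k n (real n * (1 - F (a n * x + b n)))"
  using assms by (simp add: kth_extreme_density_def beta_kernel_def)

lemma kth_extreme_density_nonneg:
  assumes "0 < a n"
  shows "0 \<le> kth_extreme_density F f a b k n x"
  unfolding kth_extreme_density_def using assms f_nonneg F_nonneg F_le_1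
  by (intro mult_nonneg_nonneg divide_nonneg_nonneg zero_le_power) (auto simp: less_imp_le)

text \<open>Three substitutions: y = a_n x + b_n, then s = 1 - F y by \<open>transport\<close>, then
  v = n s. The function \<open>w\<close> is the integrand with the factor f y taken out, which
  \<open>transport\<close> consumes.\<close>

lemma kth_extreme_density_entropy:
  assumes n: "1 \<le> n" and an: "0 < a n"
  shows "integrable lborel (\<lambda>x. kth_extreme_density F f a b k n x * ln (kth_extreme_density F f a b k n x))
      \<longleftrightarrow> integrable lborel (tail_entropy_integrand k (\<lambda>s. f (T s)) (a n) n)"
    and "(\<integral>x. kth_extreme_density F f a b k n x * ln (kth_extreme_density F f a b k n x) \<partial>lborel)
      = (\<integral>v. tail_entropy_integrand k (\<lambda>s. f (T s)) (a n) n v \<partial>lborel)"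
proof -
  define w where "w y = real n * (beta_kernel k n (real n * (1 - F y)) *
      ln (real n * a n * f y * beta_kernel k n (real n * (1 - F y))))" for y
  have w [measurable]: "w \<in> borel_measurable borel"
    unfolding w_def[abs_def] by measurable
  let ?g = "kth_extreme_density F f a b k n" and ?J = "tail_entropy_integrand k (\<lambda>s. f (T s)) (a n) n"
  have g: "?g x * ln (?g x) = a n * (f (b n + a n * x) * w (b n + a n * x))" for x
    by (simp add: kth_extreme_density_eq[OF n] w_def add.commute)
  have J: "indicator {0<..<1} s * w (T s) = real n * ?J (0 + real n * s)" for s
    using n by (auto simp: w_def tail_entropy_integrand_def F_T indicator_def zero_less_mult_iff)
  have "integrable lborel (\<lambda>x. ?g x * ln (?g x)) \<longleftrightarrow> integrable lborel (\<lambda>x. f (b n + a n * x) * w (b n + a n * x))"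
    unfolding g using an by simp
  also have "\<dots> \<longleftrightarrow> integrable lborel (\<lambda>x. f x * w x)"
    using an by (intro lborel_integrable_real_affine_iff) simp
  also have "\<dots> \<longleftrightarrow> integrable lborel (\<lambda>s. ?J (0 + real n * s))"
    unfolding transport(1)[OF w] J using n by simp
  also have "\<dots> \<longleftrightarrow> integrable lborel ?J"
    using n by (intro lborel_integrable_real_affine_iff) simp
  finally show "integrable lborel (\<lambda>x. ?g x * ln (?g x)) \<longleftrightarrow> integrable lborel ?J" .
  have "(\<integral>x. ?g x * ln (?g x) \<partial>lborel) = a n * (\<integral>x. f (b n + a n * x) * w (b n + a n * x) \<partial>lborel)"
    unfolding g by simp
  also have "\<dots> = (\<integral>x. f x * w x \<partial>lborel)"
    using an lborel_integral_real_affine[of "a n" "\<lambda>x. f x * w x" "b n"] by simp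
  also have "\<dots> = real n * (\<integral>s. ?J (0 + real n * s) \<partial>lborel)"
    unfolding transport(2)[OF w] J by simp
  also have "\<dots> = (\<integral>v. ?J v \<partial>lborel)"
    using n lborel_integral_real_affine[of "real n" ?J 0] by simp
  finally show "(\<integral>x. ?g x * ln (?g x) \<partial>lborel) = (\<integral>v. ?J v \<partial>lborel)" .
qed

lemma emeasure_D_Ioc:
  assumes "x \<le> y"
  shows "ennreal (F y - F x) = (\<integral>\<^sup>+t. ennreal (f t) * indicator {x<..y} t \<partial>lborel)"
proof -
  have "ennreal (F y - F x) = emeasure D {x<..y}"
    using assms by (simp add: D.emeasure_Ioc F_eq)
  then show ?thesis by (simp add: D_def emeasure_density)
qed

text \<open>The endpoints are an infimum and a supremum, so strictness needs a further point on each
  side; continuity of F supplies it.\<close>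

lemma between_endpoints:
  assumes "0 < F x" "F x < 1"
  shows "left_endpoint F < ereal x" "ereal x < right_endpoint F"
proof -
  have F: "F \<midarrow>x\<rightarrow> F x" using F_cont[of x] by (simp add: isCont_def)
  then have l: "(F \<longlongrightarrow> F x) (at_left x)" and r: "(F \<longlongrightarrow> F x) (at_right x)"
    by (auto simp: filterlim_at_split)
  obtain y where "0 < F y" "y < x"
    using eventually_at_left_real_ex[OF order_tendstoD(1)[OF l assms(1)]] by blast
  then show "left_endpoint F < ereal x"
    unfolding left_endpoint_def by (intro Inf_less_iff[THEN iffD2]) auto
  obtain y where "F y < 1" "x < y"
    using eventually_at_right_real_ex[OF order_tendstoD(2)[OF r assms(2)]] by blast
  then show "ereal x < right_endpoint F"
    unfolding right_endpoint_def by (intro less_Sup_iff[THEN iffD2]) auto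
qed

end

text \<open>The conditions are phrased through 0 < F and F < 1 instead of the extended real
  endpoints, which matches points T s with 0 < s < 1.\<close>

locale monotone_pdf = cdf_with_pdf +
  assumes f_antimono: "\<And>x y. 0 < F x \<Longrightarrow> x \<le> y \<Longrightarrow> F y < 1 \<Longrightarrow> f y \<le> f x"
    and f_pos: "\<And>x. 0 < F x \<Longrightarrow> F x < 1 \<Longrightarrow> 0 < f x"
begin

lemma monotone_tail_quantile:
  assumes "entropy_exists f"
  shows "monotone_tail (\<lambda>s. f (T s))"
proof
  show "0 < f (T s)" if "0 < s" "s < 1" for s
    using that by (intro f_pos) (simp_all add: F_T)
  show "f (T s) \<le> f (T t)" if "0 < s" "s \<le> t" "t < 1" for s t
    using that by (intro f_antimono) (simp_all add: F_T T_le_iff)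
  have "integrable lborel (\<lambda>x. f x * ln (f x))"
    using assms f_nonneg by (simp add: entropy_exists_iff)
  then show "integrable lborel (\<lambda>s. indicator {0<..<1} s * ln (f (T s)))"
    using transport(1)[of "\<lambda>x. ln (f x)"] by simp
qed

text \<open>Concavity of F where 0 < F < 1: an increment of F is the integral of f, and f is at most
  f q to the right of q and at least f q to the left.\<close>

lemma subgradient:
  assumes q: "0 < F q" "F q < 1" and z: "0 < F z" "F z < 1"
  shows "F z - F q \<le> f q * (z - q)"
proof (cases "q \<le> z")
  case True
  have "ennreal (F z - F q) \<le> (\<integral>\<^sup>+t. ennreal (f q) * indicator {q<..z} t \<partial>lborel)"
    unfolding emeasure_D_Ioc[OF True] using q z F_mono[of _ z]
    by (intro nn_integral_mono) (auto simp: indicator_def intro!: ennreal_leI f_antimono intro: order.strict_trans1)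
  also have "\<dots> = ennreal (f q * (z - q))"
    using True f_nonneg by (simp add: nn_integral_cmult ennreal_mult)
  finally show ?thesis using True f_nonneg by (subst (asm) ennreal_le_iff) auto
next
  case False
  then have le: "z \<le> q" by simp
  have "ennreal (f q * (q - z)) = (\<integral>\<^sup>+t. ennreal (f q) * indicator {z<..q} t \<partial>lborel)"
    using le f_nonneg by (simp add: nn_integral_cmult ennreal_mult)
  also have "\<dots> \<le> ennreal (F q - F z)"
    unfolding emeasure_D_Ioc[OF le] using q z F_mono[of z]
    by (intro nn_integral_mono) (auto simp: indicator_def intro!: ennreal_leI f_antimono intro: order.strict_trans2)
  finally show ?thesis using F_mono[OF le] by (subst (asm) ennreal_le_iff) (auto simp: algebra_simps)
qed

end

text \<open>Taking logarithms, n (- ln p) tends to H, which forces p to 1. Then p (- ln p) <= 1 - p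
  <= - ln p squeezes n (1 - p).\<close>

lemma scaled_tail_limit:
  fixes p :: "nat \<Rightarrow> real"
  assumes p: "\<And>n. 0 \<le> p n" "\<And>n. p n \<le> 1" and lim: "(\<lambda>n. p n ^ n) \<longlonglongrightarrow> exp (- H)"
  shows "(\<lambda>n. real n * (1 - p n)) \<longlonglongrightarrow> H"
proof -
  have "\<forall>\<^sub>F n in sequentially. 0 < p n ^ n"
    using lim by (rule order_tendstoD) simp
  then have pos: "\<forall>\<^sub>F n in sequentially. 0 < p n"
    using eventually_gt_at_top[of 0]
  proof eventually_elim
    case (elim n)
    then have "p n \<noteq> 0" by (metis less_irrefl power_0_left not_gr_zero)
    then show ?case using p(1)[of n] by simp
  qed
  have "(\<lambda>n. - ln (p n ^ n)) \<longlonglongrightarrow> - ln (exp (- H))"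
    by (intro tendsto_intros lim) simp
  then have "(\<lambda>n. - ln (p n ^ n)) \<longlonglongrightarrow> H" by simp
  moreover have "\<forall>\<^sub>F n in sequentially. - ln (p n ^ n) = real n * (- ln (p n))"
    using pos by eventually_elim (simp add: ln_realpow)
  ultimately have l: "(\<lambda>n. real n * (- ln (p n))) \<longlonglongrightarrow> H"
    by (rule Lim_transform_eventually)
  have "(\<lambda>n. real n * (- ln (p n)) / real n) \<longlonglongrightarrow> 0"
    by (rule real_tendsto_divide_at_top[OF l filterlim_real_sequentially])
  moreover have "\<forall>\<^sub>F n in sequentially. real n * (- ln (p n)) / real n = - ln (p n)"
    using eventually_gt_at_top[of 0] by eventually_elim simp
  ultimately have "(\<lambda>n. - ln (p n)) \<longlonglongrightarrow> 0" by (rule Lim_transform_eventually)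
  then have "(\<lambda>n. exp (- (- ln (p n)))) \<longlonglongrightarrow> exp (- 0)" by (intro tendsto_intros)
  then have "(\<lambda>n. exp (ln (p n))) \<longlonglongrightarrow> 1" by simp
  moreover have "\<forall>\<^sub>F n in sequentially. exp (ln (p n)) = p n" using pos by eventually_elim simp
  ultimately have p1: "p \<longlonglongrightarrow> 1" by (rule Lim_transform_eventually)
  have lo: "(\<lambda>n. p n * (real n * (- ln (p n)))) \<longlonglongrightarrow> H"
    using tendsto_mult[OF p1 l] by simp
  show ?thesis
  proof (rule tendsto_sandwich[OF _ _ lo l])
    show "\<forall>\<^sub>F n in sequentially. p n * (real n * (- ln (p n))) \<le> real n * (1 - p n)"
      using pos
    proof eventually_elim
      case (elim n)
      have "- ln (p n) \<le> 1 / p n - 1" using ln_le_minus_one[of "1 / p n"] elim by (simp add: ln_div)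
      then have "p n * (- ln (p n)) \<le> p n * (1 / p n - 1)" using elim by (intro mult_left_mono) auto
      also have "\<dots> = 1 - p n" using elim by (simp add: algebra_simps)
      finally show ?case using mult_left_mono[of "p n * (- ln (p n))" "1 - p n" "real n"] by (simp add: mult.left_commute)
    qed
    show "\<forall>\<^sub>F n in sequentially. real n * (1 - p n) \<le> real n * (- ln (p n))"
      using pos
    proof eventually_elim
      case (elim n)
      then show ?case using ln_le_minus_one[of "p n"] by (intro mult_left_mono) auto
    qed
  qed
qed

subsection \<open>Limit laws\<close>

text \<open>Common form of the three cases: H is - ln G on the open set U, h is - H', and \<xi> is
  the inverse of H.\<close>

locale limit_law =
  fixes U :: "real set" and H h \<xi> :: "real \<Rightarrow> real"
  assumes open_U: "open U"
    and H_pos: "\<And>x. x \<in> U \<Longrightarrow> 0 < H x"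
    and H_deriv: "\<And>x. x \<in> U \<Longrightarrow> (H has_real_derivative - h x) (at x)"
    and h_pos: "\<And>x. x \<in> U \<Longrightarrow> 0 < h x"
    and H_strict: "\<And>x y. x \<in> U \<Longrightarrow> y \<in> U \<Longrightarrow> x < y \<Longrightarrow> H y < H x"
    and \<xi>: "\<And>v. 0 < v \<Longrightarrow> \<xi> v \<in> U" "\<And>v. 0 < v \<Longrightarrow> H (\<xi> v) = v"
begin

text \<open>The density of \<xi> V for a gamma variable V with shape k and rate 1.\<close>

definition limit_density :: "nat \<Rightarrow> real \<Rightarrow> real" where
  "limit_density k x = (if x \<in> U then h x * gamma_kernel k (H x) else 0)"

lemma H_inj: "inj_on H U"
  by (rule linorder_inj_onI) (use H_strict in fastforce)+

lemma H_image: "H ` U = {0<..}"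
  using H_pos \<xi> by (force simp: image_iff)

lemma \<xi>_H: "x \<in> U \<Longrightarrow> \<xi> (H x) = x"
  using H_inj \<xi> H_pos by (auto simp: inj_on_def)

lemma limit_density_nonneg: "0 \<le> limit_density k x"
  using h_pos gamma_kernel_pos H_pos by (auto simp: limit_density_def intro!: mult_nonneg_nonneg less_imp_le)

text \<open>Substitution v = H x, under which h is the absolute Jacobian and \<xi> (H x) =
  x.\<close>

lemma limit_density_entropy:
  fixes k :: nat
  defines "\<Psi> \<equiv> \<lambda>v. gamma_kernel k v * ln (h (\<xi> v) * gamma_kernel k v)"
  assumes meas: "limit_density k \<in> borel_measurable borel"
    and int: "integrable lborel (\<lambda>v. indicator {0<..} v * \<Psi> v)"
  shows "integrable lborel (\<lambda>x. limit_density k x * ln (limit_density k x))"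
    and "(\<integral>x. limit_density k x * ln (limit_density k x) \<partial>lborel) = (\<integral>v. indicator {0<..} v * \<Psi> v \<partial>lborel)"
proof -
  let ?e = "\<lambda>x. limit_density k x * ln (limit_density k x)"
  have e_meas: "?e \<in> borel_measurable borel" using meas by measurable
  have set\<Psi>: "set_integrable lborel {0<..} \<Psi>" using int by (simp add: set_integrable_def)
  \<comment> \<open>The substitution theorem concerns Lebesgue measure, the completion of
    \<open>lborel\<close>; Borel measurability of the limit density later brings the result
    back.\<close>
  then have leb\<Psi>: "\<Psi> absolutely_integrable_on {0<..}"
    unfolding set_integrable_def
    by (subst integrable_completion) (auto dest: borel_measurable_integrable)
  have e_eq: "\<bar>- h x\<bar> * \<Psi> (H x) = ?e x" if "x \<in> U" for x
    using that h_pos[OF that] by (simp add: \<Psi>_def \<xi>_H limit_density_def)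
  have "(\<lambda>x. \<bar>- h x\<bar> * \<Psi> (H x)) absolutely_integrable_on U \<and>
      integral U (\<lambda>x. \<bar>- h x\<bar> * \<Psi> (H x)) = integral {0<..} \<Psi>"
    using has_absolute_integral_change_of_variables_1'[of U H "\<lambda>x. - h x" \<Psi> "integral {0<..} \<Psi>"]
      open_U H_deriv H_inj leb\<Psi> by (auto simp: H_image intro: has_field_derivative_at_within lmeasurable_open)
  then have "(\<lambda>x. ?e x) absolutely_integrable_on U \<and> integral U ?e = integral {0<..} \<Psi>"
    using e_eq by (metis (mono_tags, lifting) integral_cong set_integrable_cong)
  moreover have eU: "indicator U x *\<^sub>R ?e x = ?e x" for x by (simp add: limit_density_def)
  ultimately have leb: "integrable lebesgue ?e" and I: "integral U ?e = integral {0<..} \<Psi>"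
    by (simp_all only: set_integrable_def eU)
  show int_e: "integrable lborel ?e"
    using leb e_meas by (subst (asm) integrable_completion) auto
  have "set_integrable lborel U ?e" using int_e by (simp only: set_integrable_def eU)
  then have "(\<integral>x. ?e x \<partial>lborel) = integral U ?e"
    using set_borel_integral_eq_integral(2)[of U ?e] by (simp only: set_lebesgue_integral_def eU)
  also have "\<dots> = (\<integral>v. indicator {0<..} v * \<Psi> v \<partial>lborel)"
    using set_borel_integral_eq_integral(2)[OF set\<Psi>] I by (simp add: set_lebesgue_integral_def)
  finally show "(\<integral>x. ?e x \<partial>lborel) = (\<integral>v. indicator {0<..} v * \<Psi> v \<partial>lborel)" .
qed

text \<open>Below, \<open>w n\<close> is a convex function converging to \<open>H\<close>, \<open>q n\<close> is the point where
  \<open>w n\<close> takes the value \<open>v\<close>, and \<open>- p n\<close> is a subgradient of \<open>w n\<close> there.\<close>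

lemma subgradient_limit:
  fixes w :: "nat \<Rightarrow> real \<Rightarrow> real" and p q :: "nat \<Rightarrow> real"
  assumes v: "0 < v"
    and w: "\<And>z. z \<in> U \<Longrightarrow> (\<lambda>n. w n z) \<longlonglongrightarrow> H z"
    and left: "\<And>z. z \<in> U \<Longrightarrow> \<forall>\<^sub>F n in sequentially. v < w n z \<longrightarrow> z \<le> q n"
    and right: "\<And>z. z \<in> U \<Longrightarrow> \<forall>\<^sub>F n in sequentially. w n z < v \<longrightarrow> q n \<le> z"
    and sub: "\<And>z. z \<in> U \<Longrightarrow> \<forall>\<^sub>F n in sequentially. v - w n z \<le> p n * (z - q n)"
  shows "p \<longlonglongrightarrow> h (\<xi> v)"
proof -
  define x where "x = \<xi> v"
  have x: "x \<in> U" "H x = v" using \<xi> v by (auto simp: x_def)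
  have nearU: "\<forall>\<^sub>F z in at_left x. z \<in> U" "\<forall>\<^sub>F z in at_right x. z \<in> U"
    using eventually_at_topological open_U x(1) by blast+
  have pt_left: "\<exists>z\<in>U. z < x \<and> P z" if "\<forall>\<^sub>F z in at_left x. P z" for P
    using eventually_at_left_real_ex[OF eventually_conj[OF nearU(1) that]] by blast
  have pt_right: "\<exists>z\<in>U. x < z \<and> P z" if "\<forall>\<^sub>F z in at_right x. P z" for P
    using eventually_at_right_real_ex[OF eventually_conj[OF nearU(2) that]] by blast
  \<comment> \<open>Any z in U left of x has H z > v, hence eventually w n z > v and z <= q n;
    symmetrically on the right.\<close>
  have q: "q \<longlonglongrightarrow> x"
  proof (rule order_tendstoI)
    fix c assume "c < x"
    then have "\<forall>\<^sub>F z in at_left x. c < z" by (rule eventually_at_left_real[THEN eventually_mono]) auto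
    then obtain z where z: "z \<in> U" "z < x" "c < z" using pt_left by blast
    then have "v < H z" using H_strict[of z x] x by auto
    from order_tendstoD(1)[OF w[OF z(1)] this] left[OF z(1)]
    show "\<forall>\<^sub>F n in sequentially. c < q n" by eventually_elim (use z in auto)
  next
    fix c assume "x < c"
    then have "\<forall>\<^sub>F z in at_right x. z < c" by (rule eventually_at_right_real[THEN eventually_mono]) auto
    then obtain z where z: "z \<in> U" "x < z" "z < c" using pt_right by blast
    then have "H z < v" using H_strict[of x z] x by auto
    from order_tendstoD(2)[OF w[OF z(1)] this] right[OF z(1)]
    show "\<forall>\<^sub>F n in sequentially. q n < c" by eventually_elim (use z in auto)
  qed
  have slope: "((\<lambda>z. (v - H z) / (z - x)) \<longlongrightarrow> h x) (at x)"
  proof -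
    have "((\<lambda>z. - ((H z - H x) / (z - x))) \<longlongrightarrow> - (- h x)) (at x)"
      using H_deriv[OF x(1)] by (intro tendsto_minus) (simp add: has_field_derivative_iff)
    then show ?thesis by (simp add: x minus_divide_left)
  qed
  then have slope_left: "((\<lambda>z. (v - H z) / (z - x)) \<longlongrightarrow> h x) (at_left x)"
    and slope_right: "((\<lambda>z. (v - H z) / (z - x)) \<longlongrightarrow> h x) (at_right x)"
    by (auto simp: filterlim_at_split)
  \<comment> \<open>At a fixed z the subgradient inequality passes to the limit. Dividing by z - q
    n, whose sign is eventually that of z - x, bounds p n below when z > x and above when z < x; the
    difference quotients of H then close the gap.\<close>
  have cmp: "\<forall>\<^sub>F n in sequentially. c * (z - q n) < p n * (z - q n)"
    if z: "z \<in> U" and c: "c * (z - x) < v - H z" for c z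
  proof -
    have "(\<lambda>n. v - w n z - c * (z - q n)) \<longlonglongrightarrow> v - H z - c * (z - x)"
      by (intro tendsto_intros w z q)
    then have "\<forall>\<^sub>F n in sequentially. 0 < v - w n z - c * (z - q n)"
      by (rule order_tendstoD) (use c in simp)
    then show ?thesis using sub[OF z] by eventually_elim linarith
  qed
  have "p \<longlonglongrightarrow> h x"
  proof (rule order_tendstoI)
    fix c assume "c < h x"
    then obtain z where z: "z \<in> U" "x < z" "c < (v - H z) / (z - x)"
      using pt_right[OF order_tendstoD(1)[OF slope_right]] by blast
    then have "c * (z - x) < v - H z" by (simp add: pos_less_divide_eq)
    from cmp[OF z(1) this] order_tendstoD(2)[OF q z(2)]
    show "\<forall>\<^sub>F n in sequentially. c < p n" by eventually_elim simp
  next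
    fix c assume "h x < c"
    then obtain z where z: "z \<in> U" "z < x" "(v - H z) / (z - x) < c"
      using pt_left[OF order_tendstoD(2)[OF slope_left]] by blast
    then have "c * (z - x) < v - H z" by (simp add: neg_divide_less_eq)
    from cmp[OF z(1) this] order_tendstoD(1)[OF q z(2)]
    show "\<forall>\<^sub>F n in sequentially. p n < c" by eventually_elim (simp add: mult_less_cancel_right)
  qed
  then show ?thesis by (simp add: x_def)
qed

end

text \<open>The case of \<open>subgradient_limit\<close> where w n is the scaled tail n (1 - F) in
  normalized coordinates and q n is the normalized upper v/n-quantile.\<close>

lemma (in monotone_pdf) tail_density_limit:
  assumes "limit_law U H h \<xi>"
    and a: "\<And>n. 1 \<le> n \<Longrightarrow> 0 < a n"
    and lim: "\<And>z. z \<in> U \<Longrightarrow> (\<lambda>n. F (a n * z + b n) ^ n) \<longlonglongrightarrow> exp (- H z)"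
    and v: "0 < v"
  shows "(\<lambda>n. real n * a n * f (T (v / real n))) \<longlonglongrightarrow> h (\<xi> v)"
proof -
  interpret limit_law U H h \<xi> by fact
  define w where "w n z = real n * (1 - F (a n * z + b n))" for n z
  define q where "q n = (T (v / real n) - b n) / a n" for n
  have w: "(\<lambda>n. w n z) \<longlonglongrightarrow> H z" if "z \<in> U" for z
    unfolding w_def using that by (intro scaled_tail_limit F_nonneg F_le_1 lim)
  have large: "\<forall>\<^sub>F n in sequentially. 1 \<le> n \<and> v < real n"
    using eventually_gt_at_top[of "nat \<lceil>\<bar>v\<bar>\<rceil>"] by eventually_elim linarith
  show ?thesis
  proof (rule subgradient_limit[OF v w])
    fix z assume z: "z \<in> U"
    show "\<forall>\<^sub>F n in sequentially. v < w n z \<longrightarrow> z \<le> q n"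
      using large
    proof eventually_elim
      case (elim n)
      have s: "0 < v / real n" "v / real n < 1" using v elim by auto
      show ?case
        using T_le_iff[OF s, of "a n * z + b n"] elim a[of n]
        by (auto simp: w_def q_def field_simps)
    qed
    show "\<forall>\<^sub>F n in sequentially. w n z < v \<longrightarrow> q n \<le> z"
      using large
    proof eventually_elim
      case (elim n)
      have s: "0 < v / real n" "v / real n < 1" using v elim by auto
      show ?case
        using T_le_iff[OF s, of "a n * z + b n"] elim a[of n]
        by (auto simp: w_def q_def field_simps)
    qed
    \<comment> \<open>The inequality of \<open>subgradient\<close> needs 0 < F < 1 at a_n z + b_n: F
      < 1 since w n z has a positive limit, and F > 0 since F^n has one.\<close>
    have "\<forall>\<^sub>F n in sequentially. 0 < w n z"
      using order_tendstoD(1)[OF w[OF z] H_pos[OF z]] .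
    moreover have "\<forall>\<^sub>F n in sequentially. 0 < F (a n * z + b n) ^ n"
      using order_tendstoD(1)[OF lim[OF z], of 0] by simp
    ultimately show "\<forall>\<^sub>F n in sequentially. v - w n z \<le> real n * a n * f (T (v / real n)) * (z - q n)"
      using large
    proof eventually_elim
      case (elim n)
      have s: "0 < v / real n" "v / real n < 1" using v elim by auto
      have "F (a n * z + b n) \<noteq> 0" using elim by (auto simp: zero_power)
      then have z: "0 < F (a n * z + b n)" "F (a n * z + b n) < 1"
        using F_nonneg[of "a n * z + b n"] elim by (auto simp: w_def zero_less_mult_iff)
      have "F (a n * z + b n) - F (T (v / real n)) \<le> f (T (v / real n)) * (a n * z + b n - T (v / real n))"
        using s z by (intro subgradient) (simp_all add: F_T)
      also have "a n * z + b n - T (v / real n) = a n * (z - q n)"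
        using a[of n] elim by (simp add: q_def field_simps)
      finally have "real n * (F (a n * z + b n) - (1 - v / real n)) \<le> real n * (f (T (v / real n)) * (a n * (z - q n)))"
        using s by (intro mult_left_mono) (simp_all add: F_T)
      then show ?case using elim by (simp add: w_def algebra_simps)
    qed
  qed
qed

lemma (in monotone_pdf) kth_extreme_entropy_limit:
  assumes k: "2 \<le> k"
    and entropy: "entropy_exists f"
    and law: "limit_law U H h \<xi>"
    and G: "\<And>x. x \<in> U \<Longrightarrow> G x = exp (- H x)"
    and domain: "max_domain_of_attraction F G a b"
    and g: "g \<in> borel_measurable borel" "g = limit_law.limit_density U H h k"
  shows "(\<forall>n\<ge>k. entropy_exists (kth_extreme_density F f a b k n)) \<and> entropy_exists g \<and>
    (\<lambda>n. diff_entropy (kth_extreme_density F f a b k n)) \<longlonglongrightarrow> diff_entropy g"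
proof -
  interpret limit_law U H h \<xi> by fact
  have a: "0 < a n" if "1 \<le> n" for n
    using domain that by (simp add: max_domain_of_attraction_def)
  \<comment> \<open>The domain of attraction yields limits only at continuity points of G; on the
    open set U, G agrees with the continuous function exp (- H).\<close>
  have cont: "isCont G x" if "x \<in> U" for x
  proof -
    have "isCont (\<lambda>x. exp (- H x)) x"
      using DERIV_isCont[OF H_deriv[OF that]] by (intro continuous_intros)
    moreover have "\<forall>\<^sub>F y in nhds x. G y = exp (- H y)"
      using eventually_nhds_in_open[OF open_U that] by eventually_elim (rule G)
    ultimately show ?thesis by (simp add: isCont_cong)
  qed
  have lim: "(\<lambda>n. F (a n * z + b n) ^ n) \<longlonglongrightarrow> exp (- H z)" if "z \<in> U" for z
    using domain cont[OF that] unfolding G[OF that, symmetric] by (simp add: max_domain_of_attraction_def)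
  interpret tail: monotone_tail "\<lambda>s. f (T s)" by (rule monotone_tail_quantile[OF entropy])
  interpret tail: regular_tail "\<lambda>s. f (T s)" a "\<lambda>v. h (\<xi> v)"
    by unfold_locales (use a tail_density_limit[OF law a lim] h_pos \<xi> in auto)
  have nonneg: "0 \<le> kth_extreme_density F f a b k n x" if "k \<le> n" for n x
    using that k by (intro kth_extreme_density_nonneg a) simp
  have n: "entropy_exists (kth_extreme_density F f a b k n)"
    "diff_entropy (kth_extreme_density F f a b k n) = - (\<integral>v. tail_entropy_integrand k (\<lambda>s. f (T s)) (a n) n v \<partial>lborel)"
    if "k \<le> n" for n
  proof -
    have n1: "1 \<le> n" and k1: "1 \<le> k" using k that by auto
    note e = kth_extreme_density_entropy[where a = a and b = b and k = k, OF n1 a[OF n1]]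
    show "entropy_exists (kth_extreme_density F f a b k n)"
      unfolding entropy_exists_iff[OF nonneg[OF that]] e
      by (rule tail.tail_entropy_integrand_integrable[OF k1 that a[OF n1]])
    show "diff_entropy (kth_extreme_density F f a b k n) = - (\<integral>v. tail_entropy_integrand k (\<lambda>s. f (T s)) (a n) n v \<partial>lborel)"
      unfolding diff_entropy_eq[OF nonneg[OF that]] e ..
  qed
  note l = tail.tail_entropy_limit[OF k]
  note ge = limit_density_entropy[OF g(1)[unfolded g(2)] l(1), folded g(2)]
  have g_nonneg: "0 \<le> g x" for x by (simp add: g(2) limit_density_nonneg)
  have "(\<lambda>n. - (\<integral>v. tail_entropy_integrand k (\<lambda>s. f (T s)) (a n) n v \<partial>lborel)) \<longlonglongrightarrow> diff_entropy g"
    unfolding diff_entropy_eq[OF g_nonneg] ge(2) by (intro tendsto_minus l(2))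
  moreover have "\<forall>\<^sub>F m in sequentially. - (\<integral>v. tail_entropy_integrand k (\<lambda>s. f (T s)) (a m) m v \<partial>lborel)
      = diff_entropy (kth_extreme_density F f a b k m)"
    using eventually_ge_at_top[of k] by eventually_elim (simp add: n)
  ultimately have "(\<lambda>n. diff_entropy (kth_extreme_density F f a b k n)) \<longlonglongrightarrow> diff_entropy g"
    by (rule Lim_transform_eventually)
  then show ?thesis using n ge(1) by (simp add: entropy_exists_iff[OF g_nonneg])
qed

section \<open>The three max stable laws as limit laws\<close>

lemma frechet_limit_law:
  assumes "0 < \<alpha>"
  shows "limit_law {0<..} (\<lambda>x. x powr (- \<alpha>)) (\<lambda>x. \<alpha> * x powr (- \<alpha> - 1)) (\<lambda>v. v powr (- 1 / \<alpha>))"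
proof
  show "((\<lambda>x. x powr (- \<alpha>)) has_real_derivative - (\<alpha> * x powr (- \<alpha> - 1))) (at x)" if "x \<in> {0<..}" for x
    using that by (auto intro!: derivative_eq_intros)
  show "y powr (- \<alpha>) < x powr (- \<alpha>)" if "x \<in> {0<..}" "x < y" for x y
    using that assms by (intro powr_less_mono2_neg) auto
qed (use assms in \<open>auto simp: powr_powr\<close>)

lemma weibull_limit_law:
  assumes "0 < \<alpha>"
  shows "limit_law {..<0} (\<lambda>x. (- x) powr \<alpha>) (\<lambda>x. \<alpha> * (- x) powr (\<alpha> - 1)) (\<lambda>v. - (v powr (1 / \<alpha>)))"
proof
  show "((\<lambda>x. (- x) powr \<alpha>) has_real_derivative - (\<alpha> * (- x) powr (\<alpha> - 1))) (at x)" if "x \<in> {..<0}" for x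
    using that by (auto intro!: derivative_eq_intros)
  show "(- y) powr \<alpha> < (- x) powr \<alpha>" if "y \<in> {..<0}" "x < y" for x y
    using that assms by (intro powr_less_mono2) auto
qed (use assms in \<open>auto simp: powr_powr\<close>)

lemma gumbel_limit_law: "limit_law UNIV (\<lambda>x. exp (- x)) (\<lambda>x. exp (- x)) (\<lambda>v. - ln v)"
  by unfold_locales (auto intro!: derivative_eq_intros)

lemma frechet_density_eq:
  assumes "0 < \<alpha>" "1 \<le> k"
  shows "frechet_density \<alpha> k = limit_law.limit_density {0<..} (\<lambda>x. x powr (- \<alpha>)) (\<lambda>x. \<alpha> * x powr (- \<alpha> - 1)) k"
proof (rule ext)
  fix x :: real
  \<comment> \<open>The first summand is the exponent in h, the second that of H^(k-1) in the gamma
    kernel.\<close>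
  have e: "- \<alpha> * real k - 1 = (- \<alpha> - 1) + (- \<alpha>) * real (k - 1)"
    using assms by (simp add: of_nat_diff algebra_simps)
  show "frechet_density \<alpha> k x = limit_law.limit_density {0<..} (\<lambda>x. x powr (- \<alpha>)) (\<lambda>x. \<alpha> * x powr (- \<alpha> - 1)) k x"
    unfolding frechet_density_def limit_law.limit_density_def[OF frechet_limit_law[OF assms(1)]] gamma_kernel_def e powr_add
    by (simp add: powr_power mult.commute)
qed

lemma weibull_density_eq:
  assumes "0 < \<alpha>" "1 \<le> k"
  shows "weibull_density \<alpha> k = limit_law.limit_density {..<0} (\<lambda>x. (- x) powr \<alpha>) (\<lambda>x. \<alpha> * (- x) powr (\<alpha> - 1)) k"
proof (rule ext)
  fix x :: real
  have e: "\<alpha> * real k - 1 = (\<alpha> - 1) + \<alpha> * real (k - 1)"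
    using assms by (simp add: of_nat_diff algebra_simps)
  show "weibull_density \<alpha> k x = limit_law.limit_density {..<0} (\<lambda>x. (- x) powr \<alpha>) (\<lambda>x. \<alpha> * (- x) powr (\<alpha> - 1)) k x"
    unfolding weibull_density_def limit_law.limit_density_def[OF weibull_limit_law[OF assms(1)]] gamma_kernel_def e powr_add
    by (simp add: powr_power mult.commute)
qed

lemma gumbel_density_eq:
  assumes "1 \<le> k"
  shows "gumbel_density k = limit_law.limit_density UNIV (\<lambda>x. exp (- x)) (\<lambda>x. exp (- x)) k"
proof (rule ext)
  fix x :: real
  have e: "- real k * x = - x + real (k - 1) * (- x)"
    using assms by (simp add: of_nat_diff algebra_simps)
  show "gumbel_density k x = limit_law.limit_density UNIV (\<lambda>x. exp (- x)) (\<lambda>x. exp (- x)) k x"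
    unfolding gumbel_density_def limit_law.limit_density_def[OF gumbel_limit_law] gamma_kernel_def e exp_add exp_of_nat_mult
    by simp
qed

text \<open>Positivity near the right endpoint spreads to the whole interior: f x is at least f y
  for some y to the right of x where f is already positive.\<close>

lemma monotone_pdfI:
  assumes pdf: "has_pdf F f"
    and anti: "antimono_on {x. left_endpoint F < ereal x \<and> ereal x < right_endpoint F} f"
    and pos: "eventually_positive F f"
  shows "monotone_pdf F f"
proof -
  interpret cdf_with_pdf F f by unfold_locales (rule pdf)
  show ?thesis
  proof
    show mono: "f y \<le> f x" if "0 < F x" "x \<le> y" "F y < 1" for x y
    proof (rule monotone_onD[OF anti])
      show "x \<in> {x. left_endpoint F < ereal x \<and> ereal x < right_endpoint F}"
        "y \<in> {x. left_endpoint F < ereal x \<and> ereal x < right_endpoint F}"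
        using between_endpoints[of x] between_endpoints[of y] F_mono[OF that(2)] that by auto
    qed fact
    fix x assume x: "0 < F x" "F x < 1"
    obtain x0 where x0: "ereal x0 < right_endpoint F"
      and p: "\<And>x. x0 < x \<Longrightarrow> ereal x < right_endpoint F \<Longrightarrow> 0 < f x"
      using pos by (auto simp: eventually_positive_def)
    have "ereal (max x0 x) < right_endpoint F"
      using x0 between_endpoints(2)[OF x] by (simp add: max_def)
    then obtain y where y: "ereal (max x0 x) < ereal y" "ereal y < right_endpoint F"
      using ereal_dense2 by blast
    have "f y \<le> f x"
    proof (rule monotone_onD[OF anti])
      show "x \<in> {x. left_endpoint F < ereal x \<and> ereal x < right_endpoint F}"
        using between_endpoints[OF x] by simp
      show "y \<in> {x. left_endpoint F < ereal x \<and> ereal x < right_endpoint F}"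
        using between_endpoints(1)[OF x] y by (auto intro: order.strict_trans)
    qed (use y in simp)
    then show "0 < f x" using p[of y] y by simp
  qed
qed


theorem theorem2p1:
  fixes M :: "'a measure" and X :: "nat \<Rightarrow> 'a \<Rightarrow> real"
    and F f G :: "real \<Rightarrow> real" and a b :: "nat \<Rightarrow> real" and k :: nat
  assumes k: "k \<ge> 2"
    and pdf: "has_pdf F f"
    and nonincreasing: "antimono_on {x. left_endpoint F < ereal x \<and> ereal x < right_endpoint F} f"
    and positive: "eventually_positive F f"
    and M: "prob_space M"
    and indep: "prob_space.indep_vars M (\<lambda>_. borel) X {1..}"
    and ident: "\<And>i. i \<ge> 1 \<Longrightarrow> cdf (distr M borel (X i)) = F"
    and G: "distribution_function G" "nondegenerate G"
    and domain: "max_domain_of_attraction F G a b"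
    and kth_limit: "\<And>x. G x > 0 \<Longrightarrow>
      (\<lambda>n. measure M {\<omega> \<in> space M. order_statistic X (n - k + 1) n \<omega> \<le> a n * x + b n})
        \<longlonglongrightarrow> G x * (\<Sum>i=0..k-1. (- ln (G x)) ^ i / fact i)"
    and entropy: "entropy_exists f"
  shows
    "(\<forall>\<alpha>>0. G = frechet_df \<alpha> \<longrightarrow>
        (\<forall>n\<ge>k. entropy_exists (kth_extreme_density F f a b k n)) \<and>
        entropy_exists (frechet_density \<alpha> k) \<and>
        (\<lambda>n. diff_entropy (kth_extreme_density F f a b k n))
          \<longlonglongrightarrow> diff_entropy (frechet_density \<alpha> k)) \<and>
     (\<forall>\<alpha>>0. G = weibull_df \<alpha> \<longrightarrow>
        (\<forall>n\<ge>k. entropy_exists (kth_extreme_density F f a b k n)) \<and>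
        entropy_exists (weibull_density \<alpha> k) \<and>
        (\<lambda>n. diff_entropy (kth_extreme_density F f a b k n))
          \<longlonglongrightarrow> diff_entropy (weibull_density \<alpha> k)) \<and>
     (G = gumbel_df \<longrightarrow>
        (\<forall>n\<ge>k. entropy_exists (kth_extreme_density F f a b k n)) \<and>
        entropy_exists (gumbel_density k) \<and>
        (\<lambda>n. diff_entropy (kth_extreme_density F f a b k n))
          \<longlonglongrightarrow> diff_entropy (gumbel_density k))"
proof -
  interpret monotone_pdf F f by (rule monotone_pdfI[OF pdf nonincreasing positive])
  \<comment> \<open>Each case then supplies its limit law, the identity G = exp (- H) on U,
    measurability of the limit density, and its form as a \<open>limit_density\<close>.\<close>
  note limit = kth_extreme_entropy_limit[OF k entropy _ _ domain]
  have k1: "1 \<le> k" using k by simp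
  have "(\<forall>n\<ge>k. entropy_exists (kth_extreme_density F f a b k n)) \<and> entropy_exists (frechet_density \<alpha> k) \<and>
      (\<lambda>n. diff_entropy (kth_extreme_density F f a b k n)) \<longlonglongrightarrow> diff_entropy (frechet_density \<alpha> k)"
    if "0 < \<alpha>" "G = frechet_df \<alpha>" for \<alpha>
    by (rule limit[OF frechet_limit_law[OF that(1)] _ _ frechet_density_eq[OF that(1) k1]])
      (auto simp: that(2) frechet_df_def frechet_density_def[abs_def])
  moreover have "(\<forall>n\<ge>k. entropy_exists (kth_extreme_density F f a b k n)) \<and> entropy_exists (weibull_density \<alpha> k) \<and>
      (\<lambda>n. diff_entropy (kth_extreme_density F f a b k n)) \<longlonglongrightarrow> diff_entropy (weibull_density \<alpha> k)"
    if "0 < \<alpha>" "G = weibull_df \<alpha>" for \<alpha>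
    by (rule limit[OF weibull_limit_law[OF that(1)] _ _ weibull_density_eq[OF that(1) k1]])
      (auto simp: that(2) weibull_df_def weibull_density_def[abs_def])
  moreover have "(\<forall>n\<ge>k. entropy_exists (kth_extreme_density F f a b k n)) \<and> entropy_exists (gumbel_density k) \<and>
      (\<lambda>n. diff_entropy (kth_extreme_density F f a b k n)) \<longlonglongrightarrow> diff_entropy (gumbel_density k)"
    if "G = gumbel_df"
    by (rule limit[OF gumbel_limit_law _ _ gumbel_density_eq[OF k1]])
      (auto simp: that gumbel_df_def gumbel_density_def[abs_def])
  ultimately show ?thesis by blast
qed

end
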